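(* Let $M$ be a $C^\infty$ Riemannian manifold of dimension $n\ge 2$ and let $\Sigma$ be an orientable hypersurface of $M\times\mathbb{R}$ with no horizontal points and nonconstant angle function. Then the following statements are equivalent: (i) $\Sigma$ is a vertical helicoid; (ii) $\Sigma$ is a minimal hypersurface of $M\times\mathbb{R}$ and every horizontal section $\Sigma_t$ of $\Sigma$ is a minimal hypersurface of $M\times\{t\}$. If, in addition, $\Sigma$ is spacelike, then both (i) and (ii) are equivalent to: (iii) $\Sigma$ is zero mean isocurved.
   Context: $M\times\mathbb{R}$ carries the product metric $\langle\,,\rangle=\langle\,,\rangle_M+dt^2$ with Levi-Civita connection $\overline\nabla$; $\partial_t$ denotes the unit vertical field (gradient of the projection $\pi_{\mathbb R}$ onto $\mathbb{R}$). For an orientable hypersurface $\Sigma\subset M\times\mathbb{R}$ with unit normal $N$: the shape operator is $AX=-\overline\nabla_XN$; the mean curvature is $H=\mathrm{trace}\,A$ (not normalized); the height function is $\xi=\pi_{\mathbb{R}}|_\Sigma$, with gradient $\nabla\xi$ on $\Sigma$; the angle function is $\Theta=\langle N,\partial_t\rangle$. A horizontal point is a critical point of $\xi$, i.e. a point where $\Theta^2=1$. A horizontal section of $\Sigma$ is a set $\Sigma_t=\Sigma\cap(M\times\{t\})$ where the intersection is transversal; it is a hypersurface of $M\times\{t\}$. Vertical helicoid: a hypersurface with no horizontal points and nonconstant angle function whose horizontal sections $\Sigma_t$ are minimal hypersurfaces of $M\times\{t\}$ and such that $\langle A\nabla\xi,\nabla\xi\rangle=0$ on $\Sigma$. Lorentzian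 notions: $\langle\,,\rangle_L=\langle\,,\rangle_M-dt^2$ is the Lorentzian product metric (it has the same connection $\overline\nabla$). $\Sigma$ is spacelike if $\langle\,,\rangle_L$ is positive definite on $\Sigma$ (equivalently $2\Theta^2>1$). For spacelike $\Sigma$, let $N_L$ be the Lorentzian unit normal $N_L=\mu\,(N-2\Theta\partial_t)$, $\mu=-1/\sqrt{2\Theta^2-1}$, so $\langle N_L,N_L\rangle_L=-1$; put $A_LX=-\overline\nabla_XN_L$ and $H_L=-\mathrm{trace}\,A_L$. A spacelike $\Sigma$ is zero mean isocurved if $H=H_L=0$. *)

theory Defs
  imports "HOL-Analysis.Analysis"
begin

section \<open>Smooth maps between Euclidean spaces\<close>

text \<open>In finite dimension, \<open>f\<close> is of class \<open>C\<^sup>k\<^sup>+\<^sup>1\<close> on an open set iff it is differentiable there and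
  each of its directional derivatives is of class \<open>C\<^sup>k\<close>. Only used on open sets.\<close>

primrec Ck_on :: "nat \<Rightarrow> ('a::real_normed_vector \<Rightarrow> 'b::real_normed_vector) \<Rightarrow> 'a set \<Rightarrow> bool" where
  "Ck_on 0 f U = continuous_on U f"
| "Ck_on (Suc k) f U =
     ((\<forall>x\<in>U. f differentiable (at x)) \<and> (\<forall>v. Ck_on k (\<lambda>x. frechet_derivative f (at x) v) U))"

definition smooth_on :: "'a set \<Rightarrow> ('a::real_normed_vector \<Rightarrow> 'b::real_normed_vector) \<Rightarrow> bool" where
  "smooth_on U f \<longleftrightarrow> (\<forall>k. Ck_on k f U)"


section \<open>Riemannian manifolds\<close>

text \<open>
  A manifold structure on the type \<open>'m\<close>, of dimension \<open>DIM('e)\<close>, is given by an atlas indexed by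
  the type \<open>'i\<close>: the chart \<open>cmap P i\<close> maps \<open>cdom P i\<close> onto an open subset of \<open>'e\<close>.
  A metric is given by its coordinate expressions: \<open>metric P i x\<close> is the bilinear form
  at the point with coordinates \<open>x\<close> in the chart \<open>i\<close>.
\<close>

record ('i, 'm, 'e) manifold_data =
  cdom :: "'i \<Rightarrow> 'm set"
  cmap :: "'i \<Rightarrow> 'm \<Rightarrow> 'e"
  metric :: "'i \<Rightarrow> 'e \<Rightarrow> 'e \<Rightarrow> 'e \<Rightarrow> real"

definition cinv :: "('i, 'm, 'e) manifold_data \<Rightarrow> 'i \<Rightarrow> 'e \<Rightarrow> 'm" where
  "cinv P i = inv_into (cdom P i) (cmap P i)"

definition change_coords :: "('i, 'm, 'e) manifold_data \<Rightarrow> 'i \<Rightarrow> 'i \<Rightarrow> 'e \<Rightarrow> 'e" where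
  "change_coords P i j = cmap P j \<circ> cinv P i"

definition smooth_atlas ::
  "('i, 'm::topological_space, 'e::euclidean_space) manifold_data \<Rightarrow> bool" where
  "smooth_atlas P \<longleftrightarrow>
     (\<Union>i. cdom P i) = UNIV \<and>
     (\<forall>i. open (cdom P i) \<and> open (cmap P i ` cdom P i) \<and>
          homeomorphism (cdom P i) (cmap P i ` cdom P i) (cmap P i) (cinv P i)) \<and>
     (\<forall>i j. smooth_on (cmap P i ` (cdom P i \<inter> cdom P j)) (change_coords P i j))"

definition riemannian_metric ::
  "('i, 'm::topological_space, 'e::euclidean_space) manifold_data \<Rightarrow> bool" where
  "riemannian_metric P \<longleftrightarrow>
     (\<forall>i. \<forall>x\<in>cmap P i ` cdom P i.
        bilinear (metric P i x) \<and>
        (\<forall>u v. metric P i x u v = metric P i x v u) \<and>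
        (\<forall>u. u \<noteq> 0 \<longrightarrow> 0 < metric P i x u u)) \<and>
     (\<forall>i u v. smooth_on (cmap P i ` cdom P i) (\<lambda>x. metric P i x u v)) \<and>
     (\<forall>i j. \<forall>p\<in>cdom P i \<inter> cdom P j. \<forall>u v.
        metric P i (cmap P i p) u v =
          metric P j (cmap P j p)
            (frechet_derivative (change_coords P i j) (at (cmap P i p)) u)
            (frechet_derivative (change_coords P i j) (at (cmap P i p)) v))"

definition riemannian_manifold ::
  "('i, 'm::{t2_space,second_countable_topology}, 'e::euclidean_space) manifold_data \<Rightarrow> bool" where
  "riemannian_manifold P \<longleftrightarrow> smooth_atlas P \<and> riemannian_metric P"

text \<open>
  Each point \<open>p\<close> has a preferred chart \<open>chart_at P p\<close>, and the tangent space at \<open>p\<close> is identified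
  with \<open>'e\<close> through this chart. Thus a vector field along \<open>S\<close> is a function \<open>V :: 'm \<Rightarrow> 'e\<close>
  (restricted to \<open>S\<close>), and \<open>coords P i p v\<close> are the components in the chart \<open>i\<close> of the
  tangent vector \<open>v\<close> at \<open>p\<close>.
\<close>

definition chart_at :: "('i, 'm, 'e) manifold_data \<Rightarrow> 'm \<Rightarrow> 'i" where
  "chart_at P p = (SOME i. p \<in> cdom P i)"

definition coords ::
  "('i, 'm, 'e::euclidean_space) manifold_data \<Rightarrow> 'i \<Rightarrow> 'm \<Rightarrow> 'e \<Rightarrow> 'e" where
  "coords P i p v =
     frechet_derivative (change_coords P (chart_at P p) i) (at (cmap P (chart_at P p) p)) v"

definition inner_at :: "('i, 'm, 'e) manifold_data \<Rightarrow> 'm \<Rightarrow> 'e \<Rightarrow> 'e \<Rightarrow> real" where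
  "inner_at P p u v = metric P (chart_at P p) (cmap P (chart_at P p) p) u v"

text \<open>
  The Levi-Civita connection in the chart \<open>i\<close> is \<open>\<nabla>\<^sub>u V = DV(u) + \<Gamma>(u, V)\<close>, where \<open>\<Gamma>\<close> is
  determined by the vanishing of the torsion (symmetry of \<open>\<Gamma>\<close>) and by compatibility with the
  metric, imposed here on vector fields with constant components.
\<close>

definition christoffel ::
  "('i, 'm, 'e::euclidean_space) manifold_data \<Rightarrow> 'i \<Rightarrow> 'e \<Rightarrow> 'e \<Rightarrow> 'e \<Rightarrow> 'e" where
  "christoffel P i x =
     (THE \<Gamma>. (\<forall>u v. \<Gamma> u v = \<Gamma> v u) \<and>
        (\<forall>u v w. frechet_derivative (\<lambda>y. metric P i y v w) (at x) u =
                   metric P i x (\<Gamma> u v) w + metric P i x v (\<Gamma> u w)))"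


section \<open>Hypersurfaces\<close>

definition smooth_function_on ::
  "('i, 'm::topological_space, 'e::euclidean_space) manifold_data \<Rightarrow> 'm set \<Rightarrow> ('m \<Rightarrow> real) \<Rightarrow> bool"
  where
  "smooth_function_on P W h \<longleftrightarrow>
     (\<forall>i. smooth_on (cmap P i ` (W \<inter> cdom P i)) (h \<circ> cinv P i))"

definition differential ::
  "('i, 'm, 'e::euclidean_space) manifold_data \<Rightarrow> ('m \<Rightarrow> real) \<Rightarrow> 'm \<Rightarrow> 'e \<Rightarrow> real" where
  "differential P h p =
     frechet_derivative (h \<circ> cinv P (chart_at P p)) (at (cmap P (chart_at P p) p))"

text \<open>An (embedded) hypersurface is a subset which is locally a regular level set.\<close>

definition hypersurface ::
  "('i, 'm::topological_space, 'e::euclidean_space) manifold_data \<Rightarrow> 'm set \<Rightarrow> bool" where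
  "hypersurface P S \<longleftrightarrow>
     (\<forall>p\<in>S. \<exists>W h. open W \<and> p \<in> W \<and> smooth_function_on P W h \<and>
        S \<inter> W = {q \<in> W. h q = 0} \<and> (\<forall>q\<in>S \<inter> W. \<exists>v. differential P h q v \<noteq> 0))"

text \<open>The tangent space of \<open>S\<close> at \<open>p\<close> consists of the velocities at \<open>p\<close> of curves in \<open>S\<close>.\<close>

definition tangent_space ::
  "('i, 'm, 'e::euclidean_space) manifold_data \<Rightarrow> 'm set \<Rightarrow> 'm \<Rightarrow> 'e set" where
  "tangent_space P S p =
     {v. \<exists>\<gamma>. \<gamma> 0 = p \<and>
          (\<forall>\<^sub>F s in at (0::real). \<gamma> s \<in> S \<inter> cdom P (chart_at P p)) \<and>
          ((\<lambda>s. cmap P (chart_at P p) (\<gamma> s)) has_vector_derivative v) (at 0)}"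

text \<open>
  Derivative at \<open>p\<close>, along \<open>S\<close>, of a function defined on \<open>S\<close> (or a local extension of it).
  A derivative within a hypersurface is not unique as a linear map on \<open>'e\<close>, but its values on
  tangent vectors of the hypersurface are; it is only applied to tangent vectors.
\<close>

definition deriv_along ::
  "('i, 'm, 'e::euclidean_space) manifold_data \<Rightarrow> 'm set \<Rightarrow> ('m \<Rightarrow> 'b::real_normed_vector) \<Rightarrow>
     'm \<Rightarrow> 'e \<Rightarrow> 'b" where
  "deriv_along P S f p X =
     frechet_derivative (f \<circ> cinv P (chart_at P p))
       (at (cmap P (chart_at P p) p) within cmap P (chart_at P p) ` (S \<inter> cdom P (chart_at P p))) X"

definition cov_deriv ::
  "('i, 'm, 'e::euclidean_space) manifold_data \<Rightarrow> 'm set \<Rightarrow> ('m \<Rightarrow> 'e) \<Rightarrow> 'm \<Rightarrow> 'e \<Rightarrow> 'e" where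
  "cov_deriv P S V p X =
     deriv_along P S (\<lambda>q. coords P (chart_at P p) q (V q)) p X
     + christoffel P (chart_at P p) (cmap P (chart_at P p) p) X (V p)"

text \<open>Smoothness on \<open>S\<close> means having local smooth extensions, in every chart.\<close>

definition smooth_field_along ::
  "('i, 'm, 'e::euclidean_space) manifold_data \<Rightarrow> 'm set \<Rightarrow> ('m \<Rightarrow> 'e) \<Rightarrow> bool" where
  "smooth_field_along P S V \<longleftrightarrow>
     (\<forall>p\<in>S. \<forall>i. p \<in> cdom P i \<longrightarrow>
        (\<exists>U F. open U \<and> cmap P i p \<in> U \<and> smooth_on U F \<and>
           (\<forall>q\<in>S \<inter> cdom P i. cmap P i q \<in> U \<longrightarrow> F (cmap P i q) = coords P i q (V q))))"

definition unit_normal ::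
  "('i, 'm, 'e::euclidean_space) manifold_data \<Rightarrow> 'm set \<Rightarrow> ('m \<Rightarrow> 'e) \<Rightarrow> bool" where
  "unit_normal P S N \<longleftrightarrow>
     smooth_field_along P S N \<and>
     (\<forall>p\<in>S. inner_at P p (N p) (N p) = 1 \<and> (\<forall>X\<in>tangent_space P S p. inner_at P p (N p) X = 0))"

definition gradient_on ::
  "('i, 'm, 'e::euclidean_space) manifold_data \<Rightarrow> 'm set \<Rightarrow> ('m \<Rightarrow> real) \<Rightarrow> 'm \<Rightarrow> 'e" where
  "gradient_on P S f p =
     (THE v. v \<in> tangent_space P S p \<and>
        (\<forall>X\<in>tangent_space P S p. inner_at P p v X = deriv_along P S f p X))"

text \<open>The trace of a linear endomorphism \<open>A\<close> of a linear subspace \<open>V\<close>, which does not depend on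
  the chosen basis.\<close>

definition trace_on :: "'e::euclidean_space set \<Rightarrow> ('e \<Rightarrow> 'e) \<Rightarrow> real" where
  "trace_on V A =
     (let B = (SOME B. independent B \<and> span B = V) in \<Sum>b\<in>B. representation B (A b) b)"

definition shape_operator ::
  "('i, 'm, 'e::euclidean_space) manifold_data \<Rightarrow> 'm set \<Rightarrow> ('m \<Rightarrow> 'e) \<Rightarrow> 'm \<Rightarrow> 'e \<Rightarrow> 'e" where
  "shape_operator P S N p X = - cov_deriv P S N p X"

definition mean_curvature ::
  "('i, 'm, 'e::euclidean_space) manifold_data \<Rightarrow> 'm set \<Rightarrow> ('m \<Rightarrow> 'e) \<Rightarrow> 'm \<Rightarrow> real" where
  "mean_curvature P S N p = trace_on (tangent_space P S p) (shape_operator P S N p)"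

text \<open>Vanishing of the mean curvature does not depend on the local choice of the unit normal,
  so no global unit normal is needed for minimality.\<close>

definition minimal_hypersurface ::
  "('i, 'm::topological_space, 'e::euclidean_space) manifold_data \<Rightarrow> 'm set \<Rightarrow> bool" where
  "minimal_hypersurface P S \<longleftrightarrow>
     hypersurface P S \<and>
     (\<forall>p\<in>S. \<exists>W N. open W \<and> p \<in> W \<and> unit_normal P (S \<inter> W) N \<and>
        (\<forall>q\<in>S \<inter> W. mean_curvature P (S \<inter> W) N q = 0))"


section \<open>Hypersurfaces of \<open>M \<times> \<real>\<close>\<close>

text \<open>The atlas of \<open>M \<times> \<real>\<close> consists of the charts \<open>\<phi>\<^sub>i \<times> id\<close>. The parameter \<open>\<epsilon>\<close> is the coefficient of
  \<open>dt\<^sup>2\<close> in the metric: \<open>1\<close> for the Riemannian, \<open>-1\<close> for the Lorentzian product.\<close>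

definition product_with_line ::
  "real \<Rightarrow> ('i, 'm, 'e) manifold_data \<Rightarrow> ('i, 'm \<times> real, 'e \<times> real) manifold_data" where
  "product_with_line \<epsilon> M =
     \<lparr>cdom = (\<lambda>i. cdom M i \<times> UNIV),
      cmap = (\<lambda>i (x, t). (cmap M i x, t)),
      metric = (\<lambda>i (y, t) (u, a) (v, b). metric M i y u v + \<epsilon> * (a * b))\<rparr>"

abbreviation prod_R :: "('i, 'm, 'e) manifold_data \<Rightarrow> ('i, 'm \<times> real, 'e \<times> real) manifold_data" where
  "prod_R M \<equiv> product_with_line 1 M"

abbreviation prod_L :: "('i, 'm, 'e) manifold_data \<Rightarrow> ('i, 'm \<times> real, 'e \<times> real) manifold_data" where
  "prod_L M \<equiv> product_with_line (-1) M"

definition vertical :: "'e::euclidean_space \<times> real" where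
  "vertical = (0, 1)"

definition angle ::
  "('i, 'm, 'e::euclidean_space) manifold_data \<Rightarrow> ('m \<times> real \<Rightarrow> 'e \<times> real) \<Rightarrow> 'm \<times> real \<Rightarrow> real" where
  "angle M N p = inner_at (prod_R M) p (N p) vertical"

abbreviation height :: "'m \<times> real \<Rightarrow> real" where
  "height \<equiv> snd"

definition horizontal_point ::
  "('i, 'm, 'e::euclidean_space) manifold_data \<Rightarrow> ('m \<times> real) set \<Rightarrow> 'm \<times> real \<Rightarrow> bool" where
  "horizontal_point M S p \<longleftrightarrow>
     p \<in> S \<and> (\<forall>X\<in>tangent_space (prod_R M) S p. deriv_along (prod_R M) S height p X = 0)"

text \<open>\<open>S\<close> and \<open>M \<times> {t}\<close> are transversal: their tangent spaces together span the ambient one.\<close>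

definition transversal_at_height ::
  "('i, 'm, 'e::euclidean_space) manifold_data \<Rightarrow> ('m \<times> real) set \<Rightarrow> real \<Rightarrow> bool" where
  "transversal_at_height M S t \<longleftrightarrow>
     (\<forall>p \<in> S \<inter> (UNIV \<times> {t}).
        {X + Y |X Y. X \<in> tangent_space (prod_R M) S p \<and> Y \<in> tangent_space (prod_R M) (UNIV \<times> {t}) p}
          = UNIV)"

text \<open>The intersection of \<open>S\<close> with \<open>M \<times> {t}\<close>; the latter, with the metric induced by \<open>M \<times> \<real>\<close>, is
  identified with the Riemannian manifold \<open>M\<close> through the isometry \<open>(x, t) \<mapsto> x\<close>.\<close>

definition section_at :: "('m \<times> real) set \<Rightarrow> real \<Rightarrow> 'm set" where
  "section_at S t = fst ` (S \<inter> (UNIV \<times> {t}))"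

definition minimal_sections ::
  "('i, 'm::topological_space, 'e::euclidean_space) manifold_data \<Rightarrow> ('m \<times> real) set \<Rightarrow> bool" where
  "minimal_sections M S \<longleftrightarrow>
     (\<forall>t. transversal_at_height M S t \<longrightarrow> minimal_hypersurface M (section_at S t))"

definition vertical_helicoid ::
  "('i, 'm::topological_space, 'e::euclidean_space) manifold_data \<Rightarrow> ('m \<times> real) set \<Rightarrow>
     ('m \<times> real \<Rightarrow> 'e \<times> real) \<Rightarrow> bool" where
  "vertical_helicoid M S N \<longleftrightarrow>
     hypersurface (prod_R M) S \<and> unit_normal (prod_R M) S N \<and>
     (\<forall>p\<in>S. \<not> horizontal_point M S p) \<and>
     \<not> angle M N constant_on S \<and>
     minimal_sections M S \<and>
     (\<forall>p\<in>S. inner_at (prod_R M) p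
        (shape_operator (prod_R M) S N p (gradient_on (prod_R M) S height p))
        (gradient_on (prod_R M) S height p) = 0)"

definition spacelike ::
  "('i, 'm, 'e::euclidean_space) manifold_data \<Rightarrow> ('m \<times> real) set \<Rightarrow> bool" where
  "spacelike M S \<longleftrightarrow>
     (\<forall>p\<in>S. \<forall>X\<in>tangent_space (prod_R M) S p. X \<noteq> 0 \<longrightarrow> 0 < inner_at (prod_L M) p X X)"

definition lorentz_normal ::
  "('i, 'm, 'e::euclidean_space) manifold_data \<Rightarrow> ('m \<times> real \<Rightarrow> 'e \<times> real) \<Rightarrow>
     'm \<times> real \<Rightarrow> 'e \<times> real" where
  "lorentz_normal M N p =
     (- 1 / sqrt (2 * (angle M N p)\<^sup>2 - 1)) *\<^sub>R (N p - (2 * angle M N p) *\<^sub>R vertical)"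

text \<open>The Riemannian and the Lorentzian product metric have the same Levi-Civita connection.\<close>

definition lorentz_shape_operator ::
  "('i, 'm, 'e::euclidean_space) manifold_data \<Rightarrow> ('m \<times> real) set \<Rightarrow>
     ('m \<times> real \<Rightarrow> 'e \<times> real) \<Rightarrow> 'm \<times> real \<Rightarrow> 'e \<times> real \<Rightarrow> 'e \<times> real" where
  "lorentz_shape_operator M S N p X = - cov_deriv (prod_R M) S (lorentz_normal M N) p X"

definition lorentz_mean_curvature ::
  "('i, 'm, 'e::euclidean_space) manifold_data \<Rightarrow> ('m \<times> real) set \<Rightarrow>
     ('m \<times> real \<Rightarrow> 'e \<times> real) \<Rightarrow> 'm \<times> real \<Rightarrow> real" where
  "lorentz_mean_curvature M S N p =
     - trace_on (tangent_space (prod_R M) S p) (lorentz_shape_operator M S N p)"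

definition zero_mean_isocurved ::
  "('i, 'm::topological_space, 'e::euclidean_space) manifold_data \<Rightarrow> ('m \<times> real) set \<Rightarrow>
     ('m \<times> real \<Rightarrow> 'e \<times> real) \<Rightarrow> bool" where
  "zero_mean_isocurved M S N \<longleftrightarrow>
     hypersurface (prod_R M) S \<and> unit_normal (prod_R M) S N \<and> spacelike M S \<and>
     (\<forall>p\<in>S. mean_curvature (prod_R M) S N p = 0 \<and> lorentz_mean_curvature M S N p = 0)"

end

theory Submission
  imports Defs
begin

text \<open>
  Without horizontal points, \<open>T\<^sub>p\<Sigma>\<close> is the direct sum of the tangent space of the section through \<open>p\<close>
  and of the line spanned by \<open>\<nabla>\<xi> = \<partial>\<^sub>t - \<Theta> N\<close>, where \<open>|\<nabla>\<xi>|\<^sup>2 = 1 - \<Theta>\<^sup>2 > 0\<close>. The unit normal of the section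
  is the horizontal part of \<open>N\<close> divided by \<open>sqrt (1 - \<Theta>\<^sup>2)\<close>, and taking the trace of \<open>A\<close> along this
  decomposition gives
  \<open>H = sqrt (1 - \<Theta>\<^sup>2) H\<^sub>t + \<langle>A \<nabla>\<xi>, \<nabla>\<xi>\<rangle> / (1 - \<Theta>\<^sup>2)\<close>.
  In the spacelike case, differentiating \<open>N\<^sub>L = \<mu> (N - 2 \<Theta> \<partial>\<^sub>t)\<close> gives
  \<open>H\<^sub>L = e H + 2 e\<^sup>3 \<langle>A \<nabla>\<xi>, \<nabla>\<xi>\<rangle>\<close> with \<open>e = (2 \<Theta>\<^sup>2 - 1) powr (-1/2)\<close>.
  The equivalences follow pointwise from these two identities.
\<close>

section \<open>Smooth maps\<close>

text \<open>The obstacle is that the geometric objects are given by choices: each point has its own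
  preferred chart, derivatives are taken within \<Sigma> and are determined only on tangent vectors,
  and the connection is a definite description. Every covariant derivative is therefore computed
  from a local extension of the field in one fixed chart, where ordinary calculus applies. Traces
  are taken with families that reproduce the vectors of a subspace through linear functionals, so
  the splitting along \<nabla>\<xi> does not call for a frame adapted to the metric. The quadratic
  term appears because a tangent vector \<open>X\<close> satisfies
  \<open>\<langle>X, \<nabla>\<xi>\<rangle> = snd X\<close>: the vertical component of
  \<open>A \<nabla>\<xi>\<close> is already
  \<open>\<langle>A \<nabla>\<xi>, \<nabla>\<xi>\<rangle>\<close>. To compare normals, minimality
  (stated with local normals) is first reduced to one global normal, and each section receives the
  explicit normal built from \<open>N\<close>. Finally, absence of horizontal points makes every
  height transversal, so the pointwise identities cover all sections at once.\<close>

lemma has_derivative_cong_open: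
  assumes "open U" "x \<in> U" "\<And>y. y \<in> U \<Longrightarrow> f y = g y"
  shows "(f has_derivative D) (at x) \<longleftrightarrow> (g has_derivative D) (at x)"
proof
  show "(g has_derivative D) (at x)" if "(f has_derivative D) (at x)"
    using has_derivative_transform_within_open[OF that assms] .
  show "(f has_derivative D) (at x)" if "(g has_derivative D) (at x)"
    using has_derivative_transform_within_open[OF that assms(1,2)] assms(3) by simp
qed

lemma frechet_derivative_cong_open:
  assumes "open U" "x \<in> U" "\<And>y. y \<in> U \<Longrightarrow> f y = g y"
  shows "frechet_derivative f (at x) = frechet_derivative g (at x)"
  unfolding frechet_derivative_def using has_derivative_cong_open[OF assms] by simp

lemma Ck_on_cong:
  assumes "open U" "\<And>x. x \<in> U \<Longrightarrow> f x = g x"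
  shows "Ck_on k f U \<longleftrightarrow> Ck_on k g U"
  using assms(2)
proof (induction k arbitrary: f g)
  case 0
  then show ?case by (simp cong: continuous_on_cong)
next
  case (Suc k)
  have "f differentiable (at x) \<longleftrightarrow> g differentiable (at x)" if "x \<in> U" for x
    unfolding differentiable_def using has_derivative_cong_open[OF assms(1) that, of f g] Suc.prems by simp
  moreover have "Ck_on k (\<lambda>x. frechet_derivative f (at x) v) U \<longleftrightarrow>
      Ck_on k (\<lambda>x. frechet_derivative g (at x) v) U" for v
    using frechet_derivative_cong_open[OF assms(1), of _ f g] Suc.prems by (intro Suc.IH) simp
  ultimately show ?case by simp
qed

lemma Ck_on_SucI:
  assumes "open U" "\<And>x. x \<in> U \<Longrightarrow> (f has_derivative f' x) (at x)"
    and "\<And>v. Ck_on k (\<lambda>x. f' x v) U"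
  shows "Ck_on (Suc k) f U"
proof -
  have "frechet_derivative f (at x) = f' x" if "x \<in> U" for x
    using frechet_derivative_at[OF assms(2)[OF that]] by simp
  then have "Ck_on k (\<lambda>x. frechet_derivative f (at x) v) U" for v
    using assms(3)[of v] Ck_on_cong[OF assms(1), of "\<lambda>x. frechet_derivative f (at x) v" "\<lambda>x. f' x v"] by simp
  then show ?thesis using assms(2) by (auto simp: differentiable_def)
qed

lemma Ck_on_SucD:
  assumes "Ck_on (Suc k) f U" "x \<in> U"
  shows "(f has_derivative frechet_derivative f (at x)) (at x)"
  using assms by (simp add: frechet_derivative_works)

lemma Ck_on_Suc_imp: "Ck_on (Suc k) f U \<Longrightarrow> Ck_on k f U"
proof (induction k arbitrary: f)
  case 0
  then show ?case
    by (auto intro!: continuous_at_imp_continuous_on differentiable_imp_continuous_within)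
next
  case (Suc k)
  then show ?case unfolding Ck_on.simps(2)[of "Suc k" f] Ck_on.simps(2)[of k f] by blast
qed

lemma Ck_on_subset: "Ck_on k f U \<Longrightarrow> V \<subseteq> U \<Longrightarrow> Ck_on k f V"
  by (induction k arbitrary: f) (auto intro: continuous_on_subset)

lemma Ck_on_const: "Ck_on k (\<lambda>x. c) U"
  by (induction k arbitrary: c) auto

lemma Ck_on_linear:
  assumes "bounded_linear L" "open U"
  shows "Ck_on k L U"
proof (cases k)
  case 0
  then show ?thesis using assms by (simp add: linear_continuous_on)
next
  case (Suc l)
  then show ?thesis
    using Ck_on_SucI[where f' = "\<lambda>x. L", OF assms(2) bounded_linear_imp_has_derivative[OF assms(1)]]
    by (simp add: Ck_on_const)
qed

lemma Ck_on_linear_compose: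
  assumes "bounded_linear L" "open U" "Ck_on k f U"
  shows "Ck_on k (\<lambda>x. L (f x)) U"
  using assms(3)
proof (induction k arbitrary: f)
  case 0
  then show ?case
    using assms(1) by (simp add: bounded_linear.continuous_on)
next
  case (Suc k)
  show ?case
    by (rule Ck_on_SucI[where f' = "\<lambda>x v. L (frechet_derivative f (at x) v)", OF assms(2)
          bounded_linear.has_derivative[OF assms(1) Ck_on_SucD[OF Suc.prems]]])
      (use Suc in auto)
qed

lemma Ck_on_add:
  assumes "open U" "Ck_on k f U" "Ck_on k g U"
  shows "Ck_on k (\<lambda>x. f x + g x) U"
  using assms(2,3)
proof (induction k arbitrary: f g)
  case 0
  then show ?case by (simp add: continuous_on_add)
next
  case (Suc k)
  show ?case
    by (rule Ck_on_SucI[where f' = "\<lambda>x v. frechet_derivative f (at x) v + frechet_derivative g (at x) v",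
          OF assms(1) has_derivative_add[OF Ck_on_SucD[OF Suc.prems(1)] Ck_on_SucD[OF Suc.prems(2)]]])
      (use Suc in auto)
qed

lemma Ck_on_scaleR:
  fixes f :: "'a::real_normed_vector \<Rightarrow> real"
  assumes "open U" "Ck_on k f U" "Ck_on k g U"
  shows "Ck_on k (\<lambda>x. f x *\<^sub>R g x) U"
  using assms(2,3)
proof (induction k arbitrary: f g)
  case 0
  then show ?case by (simp add: continuous_on_scaleR)
next
  case (Suc k)
  show ?case
  proof (rule Ck_on_SucI[where f' = "\<lambda>x v. f x *\<^sub>R frechet_derivative g (at x) v
        + frechet_derivative f (at x) v *\<^sub>R g x",
          OF assms(1) has_derivative_scaleR[OF Ck_on_SucD[OF Suc.prems(1)] Ck_on_SucD[OF Suc.prems(2)]]])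
    fix v
    have "Ck_on k f U" "Ck_on k g U" using Suc.prems by (blast intro: Ck_on_Suc_imp)+
    moreover have "Ck_on k (\<lambda>x. frechet_derivative f (at x) v) U"
      "Ck_on k (\<lambda>x. frechet_derivative g (at x) v) U" using Suc.prems by auto
    ultimately show "Ck_on k (\<lambda>x. f x *\<^sub>R frechet_derivative g (at x) v
        + frechet_derivative f (at x) v *\<^sub>R g x) U"
      by (intro Ck_on_add[OF assms(1)] Suc.IH)
  qed
qed

text \<open>An affine inner map has a constant derivative, so the induction on \<open>k\<close>
  closes without products of derivatives. It covers the two inner maps that occur: the projection to
  the first factor and the inclusion of a slice at height \<open>t\<close>.\<close>

lemma Ck_on_compose_affine:
  assumes "bounded_linear l" "open U" "(\<lambda>x. c + l x) ` U \<subseteq> V" "Ck_on k f V"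
  shows "Ck_on k (\<lambda>x. f (c + l x)) U"
  using assms(4)
proof (induction k arbitrary: f)
  case 0
  have "continuous_on U (\<lambda>x. c + l x)"
    using assms(1) by (intro continuous_intros linear_continuous_on)
  then show ?case using 0 assms(3) continuous_on_compose2 by (metis Ck_on.simps(1))
next
  case (Suc k)
  have "((\<lambda>x. f (c + l x)) has_derivative (\<lambda>v. frechet_derivative f (at (c + l x)) (l v))) (at x)"
    if "x \<in> U" for x
  proof -
    have "((\<lambda>x. c + l x) has_derivative l) (at x)"
      using assms(1) by (auto intro!: derivative_eq_intros bounded_linear_imp_has_derivative)
    then show ?thesis
      using diff_chain_at[of "\<lambda>x. c + l x" l x f] Ck_on_SucD[OF Suc.prems] that assms(3)
      by (auto simp: o_def image_subset_iff)
  qed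
  then show ?case
    by (rule Ck_on_SucI[OF assms(2)]) (use Suc in auto)
qed

text \<open>The exponent is left arbitrary in the induction because differentiation lowers it by
  one. The exponent \<open>-1/2\<close> will normalise the horizontal part of
  \<open>N\<close>.\<close>

lemma Ck_on_powr:
  fixes f :: "'a::real_normed_vector \<Rightarrow> real"
  assumes "open U" "Ck_on k f U" and pos: "\<And>x. x \<in> U \<Longrightarrow> f x > 0"
  shows "Ck_on k (\<lambda>x. f x powr a) U"
  using assms(2)
proof (induction k arbitrary: a)
  case 0
  have "\<forall>x\<in>U. f x \<noteq> 0" using pos by force
  with 0 show ?case by (simp add: continuous_on_powr)
next
  case (Suc k)
  note D = Ck_on_SucD[OF Suc.prems]
  have "((\<lambda>x. f x powr a) has_derivative
      (\<lambda>v. (a * f x powr (a - 1)) *\<^sub>R frechet_derivative f (at x) v)) (at x)" if "x \<in> U" for x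
  proof -
    have "((\<lambda>s. s powr a) has_real_derivative a * f x powr (a - 1)) (at (f x))"
      using has_real_derivative_powr[OF pos[OF that]] .
    then have "((\<lambda>s. s powr a) has_derivative (\<lambda>s. (a * f x powr (a - 1)) * s)) (at (f x))"
      by (simp add: has_field_derivative_def)
    from diff_chain_at[OF D[OF that] this] show ?thesis by (simp add: o_def)
  qed
  then show ?case
  proof (rule Ck_on_SucI[OF assms(1)])
    fix v
    have f: "Ck_on k f U" by (rule Ck_on_Suc_imp[OF Suc.prems])
    have "Ck_on k (\<lambda>x. a *\<^sub>R f x powr (a - 1)) U"
      by (rule Ck_on_scaleR[OF assms(1) Ck_on_const Suc.IH[OF f]])
    then show "Ck_on k (\<lambda>x. (a * f x powr (a - 1)) *\<^sub>R frechet_derivative f (at x) v) U"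
      using Suc.prems by (intro Ck_on_scaleR[OF assms(1)]) auto
  qed
qed

section \<open>Closure properties of smooth maps\<close>

lemma smooth_on_const: "smooth_on U (\<lambda>x. c)"
  by (simp add: smooth_on_def Ck_on_const)

lemma smooth_on_linear: "bounded_linear L \<Longrightarrow> open U \<Longrightarrow> smooth_on U L"
  by (simp add: smooth_on_def Ck_on_linear)

lemma smooth_on_linear_compose:
  "bounded_linear L \<Longrightarrow> open U \<Longrightarrow> smooth_on U f \<Longrightarrow> smooth_on U (\<lambda>x. L (f x))"
  by (simp add: smooth_on_def Ck_on_linear_compose)

lemma smooth_on_add:
  "open U \<Longrightarrow> smooth_on U f \<Longrightarrow> smooth_on U g \<Longrightarrow> smooth_on U (\<lambda>x. f x + g x)"
  by (simp add: smooth_on_def Ck_on_add)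

lemma smooth_on_scaleR:
  "open U \<Longrightarrow> smooth_on U f \<Longrightarrow> smooth_on U g \<Longrightarrow> smooth_on U (\<lambda>x. f x *\<^sub>R g x)"
  by (simp add: smooth_on_def Ck_on_scaleR)

lemma smooth_on_compose_affine:
  "bounded_linear l \<Longrightarrow> open U \<Longrightarrow> (\<lambda>x. c + l x) ` U \<subseteq> V \<Longrightarrow> smooth_on V f \<Longrightarrow>
    smooth_on U (\<lambda>x. f (c + l x))"
  by (simp add: smooth_on_def Ck_on_compose_affine)

lemma smooth_on_powr:
  fixes f :: "'a::real_normed_vector \<Rightarrow> real"
  shows "open U \<Longrightarrow> smooth_on U f \<Longrightarrow> (\<And>x. x \<in> U \<Longrightarrow> f x > 0) \<Longrightarrow> smooth_on U (\<lambda>x. f x powr a)"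
  by (simp add: smooth_on_def Ck_on_powr)

lemma smooth_on_cong:
  "open U \<Longrightarrow> (\<And>x. x \<in> U \<Longrightarrow> f x = g x) \<Longrightarrow> smooth_on U f \<longleftrightarrow> smooth_on U g"
  using Ck_on_cong unfolding smooth_on_def by metis

lemma smooth_on_subset: "smooth_on U f \<Longrightarrow> V \<subseteq> U \<Longrightarrow> smooth_on V f"
  using Ck_on_subset unfolding smooth_on_def by metis

lemma smooth_on_has_derivative:
  "smooth_on U f \<Longrightarrow> x \<in> U \<Longrightarrow> (f has_derivative frechet_derivative f (at x)) (at x)"
  using Ck_on_SucD unfolding smooth_on_def by blast

lemma smooth_on_continuous_on: "smooth_on U f \<Longrightarrow> continuous_on U f"
  unfolding smooth_on_def using Ck_on.simps(1) by blast

section \<open>Velocities of curves in a subset of a normed space\<close>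

text \<open>The image of a tangent space in a chart, so that arguments about curves take place in a
  normed space. The filter \<open>at 0\<close> omits \<open>s = 0\<close>, hence \<open>x\<close>
  itself is not forced to lie in \<open>S\<close>.\<close>

definition velocities :: "'a::real_normed_vector \<Rightarrow> 'a set \<Rightarrow> 'a set" where
  "velocities x S = {v. \<exists>c. c 0 = x \<and> (\<forall>\<^sub>F s in at (0::real). c s \<in> S) \<and> (c has_vector_derivative v) (at 0)}"

text \<open>A curve differentiable at 0 is continuous there and eventually stays in
  \<open>U\<close>, so velocities depend only on the germ of the set at \<open>x\<close>.\<close>

lemma velocities_germ:
  assumes v: "v \<in> velocities x S" and U: "open U" "x \<in> U" "S \<inter> U \<subseteq> T"
  shows "v \<in> velocities x T"
proof -
  obtain c where c: "c 0 = x" "\<forall>\<^sub>F s in at (0::real). c s \<in> S" "(c has_vector_derivative v) (at 0)"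
    using v unfolding velocities_def by blast
  have "isCont c 0"
    using c(3) has_vector_derivative_continuous by blast
  then have "(c \<longlongrightarrow> x) (at 0)"
    using c(1) by (simp add: isCont_def)
  then have "\<forall>\<^sub>F s in at 0. c s \<in> U"
    using U topological_tendstoD by blast
  with c(2) have "\<forall>\<^sub>F s in at 0. c s \<in> T"
    by eventually_elim (use U(3) in auto)
  with c show ?thesis unfolding velocities_def by blast
qed

lemma has_vector_derivative_along_curve:
  assumes c: "c 0 = x" "\<forall>\<^sub>F s in at (0::real). c s \<in> S" "(c has_vector_derivative v) (at 0)"
    and f: "(f has_derivative f') (at x within S)"
  shows "((\<lambda>s. f (c s)) has_vector_derivative f' v) (at 0)"
proof -
  obtain d where d: "d > 0" "\<And>s. s \<noteq> 0 \<Longrightarrow> dist s 0 < d \<Longrightarrow> c s \<in> S"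
    using c(2) unfolding eventually_at by auto
  let ?T = "ball (0::real) d"
  have sub: "c ` ?T \<subseteq> insert x S"
  proof (rule image_subsetI)
    show "c s \<in> insert x S" if "s \<in> ?T" for s
      using d(2)[of s] c(1) that by (cases "s = 0") (auto simp: dist_commute)
  qed
  \<comment> \<open>The filter ignores \<open>x\<close>, so \<open>x\<close> may be added to
    \<open>S\<close>. The arc then lies in the set including its value at \<open>s = 0\<close>, as
    the chain rule within sets demands.\<close>
  have "at x within insert x S = at x within S"
    by (simp add: at_within_def)
  with f have "(f has_derivative f') (at (c 0) within c ` ?T)"
    using has_derivative_subset[OF _ sub] c(1) by metis
  moreover have "(c has_derivative (\<lambda>s. s *\<^sub>R v)) (at 0 within ?T)"
    using c(3) by (simp add: has_vector_derivative_def has_derivative_at_withinI)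
  ultimately have "((f \<circ> c) has_derivative (f' \<circ> (\<lambda>s. s *\<^sub>R v))) (at 0 within ?T)"
    by (intro diff_chain_within)
  moreover have "at 0 within ?T = at 0"
    using d(1) by (intro at_within_open) auto
  ultimately show ?thesis
    using has_derivative_linear[OF f] by (simp add: has_vector_derivative_def o_def linear_scale)
qed

text \<open>Both values are the velocity at 0 of the same curve \<open>f \<circ> c\<close>, although
  \<open>f'\<close> and \<open>g'\<close> may differ as linear maps.\<close>

lemma velocity_derivative_unique:
  assumes v: "v \<in> velocities x S"
    and f: "(f has_derivative f') (at x within S)" and g: "(g has_derivative g') (at x within S)"
    and U: "open U" "x \<in> U" "\<And>y. y \<in> S \<inter> U \<Longrightarrow> f y = g y" and x: "x \<in> S"
  shows "f' v = g' v"
proof -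
  obtain c where c: "c 0 = x" "\<forall>\<^sub>F s in at (0::real). c s \<in> S" "(c has_vector_derivative v) (at 0)"
    using v unfolding velocities_def by blast
  have "\<forall>\<^sub>F y in at x within S. y \<in> U"
    using U(1,2) eventually_at_topological by blast
  moreover have "\<forall>\<^sub>F y in at x within S. y \<in> S"
    by (simp add: eventually_at_filter)
  ultimately have "\<forall>\<^sub>F y in at x within S. f y = g y"
    by eventually_elim (use U(3) in auto)
  then have "(g has_derivative f') (at x within S)"
    using has_derivative_transform_eventually[OF f] U(2,3) x by blast
  from has_vector_derivative_along_curve[OF c this] has_vector_derivative_along_curve[OF c g]
  show ?thesis by (rule vector_derivative_unique_at)
qed

text \<open>\<open>frechet_derivative\<close> within a set picks one of possibly many derivatives.
  On velocities every pick agrees with the derivative of an extension, which makes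
  \<open>deriv_along\<close> computable.\<close>

lemma frechet_derivative_within_velocity:
  assumes v: "v \<in> velocities x S" and g: "(g has_derivative g') (at x)"
    and U: "open U" "x \<in> U" "\<And>y. y \<in> S \<inter> U \<Longrightarrow> f y = g y" and x: "x \<in> S"
  shows "frechet_derivative f (at x within S) v = g' v"
proof -
  have g': "(g has_derivative g') (at x within S)"
    using g by (rule has_derivative_at_withinI)
  have "\<forall>\<^sub>F y in at x within S. y \<in> U"
    using U(1,2) eventually_at_topological by blast
  moreover have "\<forall>\<^sub>F y in at x within S. y \<in> S"
    by (simp add: eventually_at_filter)
  ultimately have "\<forall>\<^sub>F y in at x within S. g y = f y"
    by eventually_elim (use U(3) in auto)
  then have "(f has_derivative g') (at x within S)"
    using has_derivative_transform_eventually[OF g'] U(2,3) x by fastforce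
  then have "(f has_derivative frechet_derivative f (at x within S)) (at x within S)"
    using frechet_derivative_works differentiable_def by blast
  from velocity_derivative_unique[OF v this g' U x] show ?thesis .
qed

text \<open>For the inclusion \<open>\<supseteq>\<close>, the curve is \<open>s \<mapsto> x + s v + r(s) w\<close> where \<open>w\<close> is transversal to the level
  set and \<open>r(s)\<close> is an almost smallest root. Roots with \<open>\<bar>r\<bar> \<le> \<epsilon> \<bar>s\<bar>\<close> exist by the intermediate
  value theorem, so that no implicit function theorem is needed.\<close>

lemma velocities_level_set:
  fixes h :: "'a::real_normed_vector \<Rightarrow> real"
  assumes U: "open U" "x \<in> U" and cont: "continuous_on U h"
    and h': "(h has_derivative h') (at x)" and hx: "h x = 0" and w0: "h' w0 \<noteq> 0"
    and S: "S \<inter> U = {y \<in> U. h y = 0}"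
  shows "velocities x S = {v. h' v = 0}"
proof (intro equalityI subsetI CollectI; (elim CollectE)?)
  fix v assume "v \<in> velocities x S"
  moreover have "(h has_derivative h') (at x within S)"
    using h' by (rule has_derivative_at_withinI)
  moreover have "x \<in> S" using S U hx by blast
  ultimately show "h' v = 0"
    using velocity_derivative_unique[of v x S h h' "\<lambda>_. 0" "\<lambda>_. 0" U] U S by auto
next
  fix v assume v: "h' v = 0"
  interpret h': bounded_linear h' using h' by (rule has_derivative_bounded_linear)
  \<comment> \<open>With \<open>h' w = 1\<close> and \<open>h' v = 0\<close>, the linear part of
    \<open>h\<close> at \<open>x + s v + r w\<close> is exactly \<open>r\<close>.\<close>
  define w where "w = w0 /\<^sub>R h' w0"
  have w: "h' w = 1" using w0 by (simp add: w_def h'.scaleR)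
  define Z where "Z s = {r. x + s *\<^sub>R v + r *\<^sub>R w \<in> U \<and> h (x + s *\<^sub>R v + r *\<^sub>R w) = 0}" for s
  have root: "\<exists>d>0. \<forall>s. s \<noteq> 0 \<and> \<bar>s\<bar> < d \<longrightarrow> (\<exists>r\<in>Z s. \<bar>r\<bar> \<le> \<epsilon> * \<bar>s\<bar>)" if \<epsilon>: "\<epsilon> > 0" for \<epsilon>
  proof -
    \<comment> \<open>For \<open>\<bar>r\<bar> \<le> \<epsilon> * \<bar>s\<bar>\<close> the point
      \<open>y r\<close> stays within \<open>\<bar>s\<bar> * K\<close> of \<open>x\<close>. A
      relative error of \<open>\<epsilon> / (2 * K)\<close> then keeps \<open>h (y r)\<close> within
      \<open>a / 2\<close> of \<open>r\<close>, which forces opposite signs at \<open>-a\<close> and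
      \<open>a\<close>.\<close>
    define K where "K = norm v + \<epsilon> * norm w + 1"
    have K: "K > 0" using \<epsilon> by (simp add: K_def add_nonneg_pos)
    obtain d1 where d1: "d1 > 0" "ball x d1 \<subseteq> U" using U open_contains_ball by blast
    obtain d2 where d2: "d2 > 0" "\<And>y. norm (y - x) < d2 \<Longrightarrow> norm (h y - h x - h' (y - x)) \<le> \<epsilon> / (2 * K) * norm (y - x)"
      using h' \<epsilon> K unfolding has_derivative_at_alt by (metis divide_pos_pos mult_pos_pos zero_less_numeral)
    define d where "d = min d1 d2 / K"
    have "d > 0" using d1 d2 K by (simp add: d_def)
    moreover have "\<exists>r\<in>Z s. \<bar>r\<bar> \<le> \<epsilon> * \<bar>s\<bar>" if s: "s \<noteq> 0" "\<bar>s\<bar> < d" for s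
    proof -
      define a where "a = \<epsilon> * \<bar>s\<bar>"
      have a: "a > 0" using s \<epsilon> by (simp add: a_def)
      define y where "y r = x + s *\<^sub>R v + r *\<^sub>R w" for r
      have bd: "norm (y r - x) \<le> \<bar>s\<bar> * K" if "\<bar>r\<bar> \<le> a" for r
      proof -
        have "norm (y r - x) \<le> \<bar>s\<bar> * norm v + \<bar>r\<bar> * norm w"
          unfolding y_def using norm_triangle_ineq[of "s *\<^sub>R v" "r *\<^sub>R w"] by (simp add: algebra_simps)
        also have "\<dots> \<le> \<bar>s\<bar> * norm v + a * norm w"
          using that by (simp add: mult_right_mono)
        also have "\<dots> \<le> \<bar>s\<bar> * K"
          by (simp add: a_def K_def algebra_simps)
        finally show ?thesis .
      qed
      have sK: "\<bar>s\<bar> * K < min d1 d2" using s(2) K by (simp add: d_def pos_less_divide_eq)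
      have yU: "y r \<in> U" if "\<bar>r\<bar> \<le> a" for r
        using bd[OF that] sK d1(2) by (auto simp: dist_norm norm_minus_commute subset_iff)
      have est: "\<bar>h (y r) - r\<bar> \<le> a / 2" if "\<bar>r\<bar> \<le> a" for r
      proof -
        have "h' (y r - x) = r"
          using v w by (simp add: y_def h'.add h'.scaleR algebra_simps)
        then have "\<bar>h (y r) - r\<bar> \<le> \<epsilon> / (2 * K) * norm (y r - x)"
          using d2(2)[of "y r"] bd[OF that] sK hx by simp
        also have "\<dots> \<le> \<epsilon> / (2 * K) * (\<bar>s\<bar> * K)"
          using bd[OF that] \<epsilon> K by (intro mult_left_mono) auto
        also have "\<dots> = a / 2" using K by (simp add: a_def)
        finally show ?thesis .
      qed
      have "\<bar>h (y a) - a\<bar> \<le> a / 2" "\<bar>h (y (-a)) - (-a)\<bar> \<le> a / 2" using est[of a] est[of "-a"] a by simp_all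
      then have "h (y (-a)) \<le> 0" "0 \<le> h (y a)" using a unfolding abs_le_iff by linarith+
      moreover have "continuous_on {-a..a} (\<lambda>r. h (y r))"
      proof (rule continuous_on_compose2[OF cont])
        show "continuous_on {-a..a} y" unfolding y_def by (intro continuous_intros)
      qed (use yU in auto)
      ultimately obtain r where "-a \<le> r" "r \<le> a" "h (y r) = 0"
        using IVT'[of "\<lambda>r. h (y r)" "-a" 0 a] a by auto
      then show ?thesis using yU[of r] by (auto simp: Z_def y_def a_def abs_le_iff)
    qed
    ultimately show ?thesis by blast
  qed
  \<comment> \<open>The roots found above depend on \<epsilon>, while the curve needs a single
    choice for each \<open>s\<close>. A root within \<open>s\<^sup>2\<close> of the smallest modulus
    satisfies all these bounds up to an error that is o(s); the minimum itself need not be attained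
    a priori.\<close>
  have "\<exists>r. s \<noteq> 0 \<and> Z s \<noteq> {} \<longrightarrow> r \<in> Z s \<and> (\<forall>r'\<in>Z s. \<bar>r\<bar> \<le> \<bar>r'\<bar> + s\<^sup>2)" for s
  proof (cases "s \<noteq> 0 \<and> Z s \<noteq> {}")
    case True
    have "Inf (abs ` Z s) < Inf (abs ` Z s) + s\<^sup>2" using True by simp
    then obtain b where "b \<in> abs ` Z s" and b: "b < Inf (abs ` Z s) + s\<^sup>2"
      using cInf_lessD[of "abs ` Z s"] True by blast
    then obtain r0 where r0: "r0 \<in> Z s" "b = \<bar>r0\<bar>" by blast
    have "bdd_below (abs ` Z s)" by (rule bdd_belowI[of _ 0]) auto
    then have "Inf (abs ` Z s) \<le> \<bar>r'\<bar>" if "r' \<in> Z s" for r'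
      using that by (intro cInf_lower) auto
    then have "\<forall>r'\<in>Z s. \<bar>r0\<bar> \<le> \<bar>r'\<bar> + s\<^sup>2"
      using b r0(2) by fastforce
    with r0(1) show ?thesis by blast
  qed auto
  then obtain r where r: "\<And>s. s \<noteq> 0 \<Longrightarrow> Z s \<noteq> {} \<Longrightarrow> r s \<in> Z s \<and> (\<forall>r'\<in>Z s. \<bar>r s\<bar> \<le> \<bar>r'\<bar> + s\<^sup>2)"
    by metis
  define c where "c s = (if s = 0 then x else x + s *\<^sub>R v + r s *\<^sub>R w)" for s
  have small: "\<exists>d>0. \<forall>s. s \<noteq> 0 \<and> \<bar>s\<bar> < d \<longrightarrow> r s \<in> Z s \<and> \<bar>r s\<bar> \<le> 2 * \<epsilon> * \<bar>s\<bar>" if \<epsilon>: "\<epsilon> > 0" for \<epsilon>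
  proof -
    obtain d where d: "d > 0" "\<And>s. s \<noteq> 0 \<Longrightarrow> \<bar>s\<bar> < d \<Longrightarrow> \<exists>r\<in>Z s. \<bar>r\<bar> \<le> \<epsilon> * \<bar>s\<bar>" using root[OF \<epsilon>] by blast
    have "r s \<in> Z s \<and> \<bar>r s\<bar> \<le> 2 * \<epsilon> * \<bar>s\<bar>" if s: "s \<noteq> 0" "\<bar>s\<bar> < min d \<epsilon>" for s
    proof -
      obtain r' where r': "r' \<in> Z s" "\<bar>r'\<bar> \<le> \<epsilon> * \<bar>s\<bar>" using d(2) s by auto
      have "s\<^sup>2 \<le> \<epsilon> * \<bar>s\<bar>"
        using mult_right_mono[of "\<bar>s\<bar>" \<epsilon> "\<bar>s\<bar>"] s by (simp add: power2_eq_square)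
      then show ?thesis using r[of s] r' s by fastforce
    qed
    then show ?thesis using d(1) \<epsilon> by (intro exI[of _ "min d \<epsilon>"]) auto
  qed
  obtain d0 where d0: "d0 > 0" "\<And>s. s \<noteq> 0 \<Longrightarrow> \<bar>s\<bar> < d0 \<Longrightarrow> r s \<in> Z s"
    using small[of 1] by auto
  have "\<forall>\<^sub>F s in at 0. c s \<in> S"
    unfolding eventually_at
  proof (intro exI conjI ballI impI)
    fix s :: real assume "s \<noteq> 0 \<and> dist s 0 < d0"
    then show "c s \<in> S" using d0(2)[of s] S by (auto simp: c_def Z_def)
  qed (use d0 in auto)
  moreover have "(c has_vector_derivative v) (at 0)"
    unfolding has_vector_derivative_def has_derivative_at_alt
  proof (intro conjI allI impI bounded_linear_scaleR_left)
    fix e :: real assume e: "e > 0"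
    define \<epsilon> where "\<epsilon> = e / (2 * (norm w + 1))"
    have "\<epsilon> > 0" using e by (simp add: \<epsilon>_def add_nonneg_pos)
    then obtain d where d: "d > 0" "\<And>s. s \<noteq> 0 \<Longrightarrow> \<bar>s\<bar> < d \<Longrightarrow> \<bar>r s\<bar> \<le> 2 * \<epsilon> * \<bar>s\<bar>" using small by metis
    have "norm (c s - c 0 - (s - 0) *\<^sub>R v) \<le> e * norm (s - 0)" if s: "norm (s - 0) < d" for s
    proof (cases "s = 0")
      case False
      have "norm (c s - c 0 - (s - 0) *\<^sub>R v) = \<bar>r s\<bar> * norm w" using False by (simp add: c_def)
      also have "\<dots> \<le> (2 * \<epsilon> * \<bar>s\<bar>) * (norm w + 1)"
        using d(2)[of s] s False by (intro mult_mono) auto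
      also have "\<dots> = e * \<bar>s\<bar>"
        using norm_ge_zero[of w] by (simp add: \<epsilon>_def field_simps del: norm_ge_zero)
      finally show ?thesis by simp
    qed auto
    then show "\<exists>d>0. \<forall>s. norm (s - 0) < d \<longrightarrow> norm (c s - c 0 - (s - 0) *\<^sub>R v) \<le> e * norm (s - 0)"
      using d(1) by blast
  qed
  moreover have "c 0 = x" by (simp add: c_def)
  ultimately show "v \<in> velocities x S" unfolding velocities_def by blast
qed

section \<open>Riemannian metrics on open subsets of Euclidean space\<close>

lemma bilinear_expand:
  fixes B :: "'e::euclidean_space \<Rightarrow> 'e \<Rightarrow> real"
  assumes "bilinear B"
  shows "B u v = (\<Sum>i\<in>Basis. \<Sum>j\<in>Basis. (u \<bullet> i) * (v \<bullet> j) * B i j)"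
proof -
  have "B u v = B (\<Sum>i\<in>Basis. (u \<bullet> i) *\<^sub>R i) (\<Sum>j\<in>Basis. (v \<bullet> j) *\<^sub>R j)"
    by (simp add: euclidean_representation)
  also have "\<dots> = (\<Sum>i\<in>Basis. \<Sum>j\<in>Basis. B ((u \<bullet> i) *\<^sub>R i) ((v \<bullet> j) *\<^sub>R j))"
    using bilinear_sum[OF assms] by (simp add: sum.cartesian_product)
  finally show ?thesis
    using assms by (simp add: bilinear_lmul bilinear_rmul mult.assoc)
qed

lemma posdef_nondegenerate:
  assumes "bilinear B" "\<And>u. u \<noteq> 0 \<Longrightarrow> 0 < B u u" "\<And>z. B u z = (B v z :: real)"
  shows "u = v"
proof (rule ccontr)
  assume "u \<noteq> v"
  then have "0 < B (u - v) (u - v)" using assms(2) by simp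
  moreover have "B (u - v) (u - v) = 0"
    using assms(3)[of "u - v"] bilinear_lsub[OF assms(1)] by simp
  ultimately show False by simp
qed

text \<open>Positivity makes \<open>w \<mapsto> B w\<close> injective into the dual space, hence
  surjective by finite dimension. It supplies both the Christoffel vectors and the vector
  representing the differential of a defining function.\<close>

lemma posdef_riesz:
  fixes B :: "'e::euclidean_space \<Rightarrow> 'e \<Rightarrow> real"
  assumes B: "bilinear B" "\<And>u. u \<noteq> 0 \<Longrightarrow> 0 < B u u" and \<phi>: "linear \<phi>"
  shows "\<exists>w. \<forall>z. B w z = \<phi> z"
proof -
  define L where "L w = (\<Sum>b\<in>Basis. B w b *\<^sub>R b)" for w
  have lin: "linear L"
    unfolding L_def using B(1)
    by (intro linearI) (simp_all add: bilinear_ladd bilinear_lmul scaleR_add_left sum.distrib scaleR_sum_right)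
  have inner: "L w \<bullet> b = B w b" if "b \<in> Basis" for w b
    using that by (simp add: L_def inner_sum_left inner_Basis if_distrib sum.delta cong: if_cong)
  have "L w = 0 \<Longrightarrow> w = 0" for w
  proof -
    assume "L w = 0"
    then have "B w b = B 0 b" if "b \<in> Basis" for b
      using inner[OF that, of w] bilinear_lzero[OF B(1)] by simp
    then have "B w = B 0"
      using B(1) by (intro linear_eq_stdbasis) (auto simp: bilinear_def)
    then show "w = 0" by (intro posdef_nondegenerate[OF B]) auto
  qed
  then have "inj L" using lin by (simp add: linear_injective_0)
  then have "surj L" using lin linear_injective_imp_surjective by blast
  then obtain w where w: "L w = (\<Sum>b\<in>Basis. \<phi> b *\<^sub>R b)" by (metis surjD)
  have "B w b = \<phi> b" if "b \<in> Basis" for b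
    using inner[OF that, of w] that
    by (simp add: w inner_sum_left inner_Basis if_distrib sum.delta cong: if_cong)
  then have "B w = \<phi>"
    using B(1) \<phi> by (intro linear_eq_stdbasis) (auto simp: bilinear_def)
  then show ?thesis by auto
qed

text \<open>All conclusions concern the one point \<open>x\<close>. The neighbourhood
  \<open>V\<close> provides room for differentiating the algebraic identities of \<open>G y\<close>
  at \<open>x\<close>.\<close>

locale local_metric =
  fixes G :: "'e::euclidean_space \<Rightarrow> 'e \<Rightarrow> 'e \<Rightarrow> real" and V :: "'e set" and x :: 'e
  assumes V: "open V" "x \<in> V"
    and bil: "\<And>y. y \<in> V \<Longrightarrow> bilinear (G y)"
    and sym: "\<And>y u v. y \<in> V \<Longrightarrow> G y u v = G y v u"
    and pos: "\<And>y u. y \<in> V \<Longrightarrow> u \<noteq> 0 \<Longrightarrow> 0 < G y u u"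
    and diff: "\<And>u v. (\<lambda>y. G y u v) differentiable (at x)"
begin

definition "dG X u v = frechet_derivative (\<lambda>y. G y u v) (at x) X"

lemma dG: "((\<lambda>y. G y u v) has_derivative (\<lambda>X. dG X u v)) (at x)"
  using diff frechet_derivative_works unfolding dG_def by blast

text \<open>Identities valid for all \<open>G y\<close> pass to the derivative at \<open>x\<close>.
  Symmetry and bilinearity of \<open>dG X\<close> are obtained this way.\<close>

lemma dG_unique:
  assumes "\<And>y. y \<in> V \<Longrightarrow> G y u v = f y" "(f has_derivative f') (at x)"
  shows "dG X u v = f' X"
proof -
  have "((\<lambda>y. G y u v) has_derivative f') (at x)"
    using has_derivative_cong_open[OF V, of "\<lambda>y. G y u v" f] assms by simp
  then show ?thesis using has_derivative_unique[OF dG, of u v f'] by (simp add: fun_eq_iff)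
qed

lemma dG_sym: "dG X u v = dG X v u"
  using dG_unique[OF sym dG] .

lemma dG_linear: "linear (\<lambda>X. dG X u v)"
  using has_derivative_linear[OF dG] .

lemma dG_linear_right: "linear (dG X u)"
proof (rule linearI)
  show "dG X u (v + w) = dG X u v + dG X u w" for v w
    using dG_unique[OF _ has_derivative_add[OF dG dG], of u "v + w" u v u w] bil
    by (simp add: bilinear_radd)
  show "dG X u (c *\<^sub>R v) = c *\<^sub>R dG X u v" for c v
    using dG_unique[OF _ has_derivative_scaleR_right[OF dG], of u "c *\<^sub>R v" c u v] bil
    by (simp add: bilinear_rmul)
qed

lemma dG_bilinear: "bilinear (dG X)"
  unfolding bilinear_def
proof (intro conjI allI dG_linear_right)
  have "(\<lambda>u. dG X u v) = dG X v" for v using dG_sym by auto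
  then show "linear (\<lambda>u. dG X u v)" for v using dG_linear_right by simp
qed

lemma Gx: "bilinear (G x)" "G x u v = G x v u" "u \<noteq> 0 \<Longrightarrow> 0 < G x u u"
  using V bil sym pos by auto

lemma Gx_eqI: "(\<And>z. G x u z = G x v z) \<Longrightarrow> u = v"
  using posdef_nondegenerate[OF Gx(1,3)] by blast

text \<open>Differentiability of \<open>G\<close> is given only for fixed vectors. Expanding both
  arguments in the standard basis reduces moving arguments to products of scalar functions.\<close>

lemma has_derivative_metric:
  assumes F: "(F has_derivative F') (at x)" and H: "(H has_derivative H') (at x)"
  shows "((\<lambda>y. G y (F y) (H y)) has_derivative
    (\<lambda>X. dG X (F x) (H x) + G x (F' X) (H x) + G x (F x) (H' X))) (at x)"
proof -
  let ?f = "\<lambda>y. \<Sum>i\<in>Basis. \<Sum>j\<in>Basis. (F y \<bullet> i) * (H y \<bullet> j) * G y i j"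
  have "((\<lambda>y. (F y \<bullet> i) * (H y \<bullet> j) * G y i j) has_derivative
      (\<lambda>X. (F x \<bullet> i) * (H x \<bullet> j) * dG X i j + (F' X \<bullet> i) * (H x \<bullet> j) * G x i j
         + (F x \<bullet> i) * (H' X \<bullet> j) * G x i j)) (at x)" for i j
    by (rule has_derivative_eq_rhs[OF has_derivative_mult[OF has_derivative_mult[OF
            has_derivative_inner_left[OF F] has_derivative_inner_left[OF H]] dG]])
      (auto simp: algebra_simps)
  then have "(?f has_derivative (\<lambda>X. \<Sum>i\<in>Basis. \<Sum>j\<in>Basis.
        (F x \<bullet> i) * (H x \<bullet> j) * dG X i j + (F' X \<bullet> i) * (H x \<bullet> j) * G x i j
         + (F x \<bullet> i) * (H' X \<bullet> j) * G x i j)) (at x)"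
    by (intro has_derivative_sum)
  moreover have "(\<Sum>i\<in>Basis. \<Sum>j\<in>Basis.
        (F x \<bullet> i) * (H x \<bullet> j) * dG X i j + (F' X \<bullet> i) * (H x \<bullet> j) * G x i j
         + (F x \<bullet> i) * (H' X \<bullet> j) * G x i j)
      = dG X (F x) (H x) + G x (F' X) (H x) + G x (F x) (H' X)" for X
    using bilinear_expand[OF dG_bilinear, of X "F x" "H x"] bilinear_expand[OF Gx(1), of "F' X" "H x"]
      bilinear_expand[OF Gx(1), of "F x" "H' X"] by (simp add: sum.distrib)
  ultimately have "(?f has_derivative
    (\<lambda>X. dG X (F x) (H x) + G x (F' X) (H x) + G x (F x) (H' X))) (at x)" by simp
  then show ?thesis
    using has_derivative_cong_open[OF V, of "\<lambda>y. G y (F y) (H y)" ?f] bilinear_expand[OF bil] by blast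
qed

text \<open>The property under the definite description in \<open>christoffel\<close>, named so that
  existence and uniqueness can be treated separately.\<close>

definition levi_civita :: "('e \<Rightarrow> 'e \<Rightarrow> 'e) \<Rightarrow> bool" where
  "levi_civita \<Gamma> \<longleftrightarrow> (\<forall>u v. \<Gamma> u v = \<Gamma> v u) \<and>
     (\<forall>u v w. frechet_derivative (\<lambda>y. G y v w) (at x) u = G x (\<Gamma> u v) w + G x v (\<Gamma> u w))"

text \<open>The Koszul formula for fields with constant components, whose brackets vanish: in the
  signed sum of three compatibility equations the symmetry of \<open>\<Gamma>\<close> leaves one
  term, counted twice. Uniqueness and bilinearity of \<open>\<Gamma>\<close> both follow from
  it.\<close>

lemma koszul:
  assumes "levi_civita \<Gamma>"
  shows "G x (\<Gamma> u v) w = (dG u v w + dG v u w - dG w u v) / 2"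
proof -
  have s: "\<Gamma> u v = \<Gamma> v u" and c: "dG u v w = G x (\<Gamma> u v) w + G x v (\<Gamma> u w)" for u v w
    using assms unfolding levi_civita_def dG_def by blast+
  have "dG v u w = G x (\<Gamma> u v) w + G x u (\<Gamma> v w)"
    using c[of v u w] unfolding s[of v u] .
  moreover have "dG w u v = G x v (\<Gamma> u w) + G x u (\<Gamma> v w)"
    using c[of w u v] unfolding s[of w u] s[of w v] Gx(2)[of "\<Gamma> u w" v] .
  ultimately show ?thesis by (simp add: c[of u v w])
qed

lemma levi_civita_unique: "levi_civita \<Gamma> \<Longrightarrow> levi_civita \<Gamma>' \<Longrightarrow> \<Gamma> = \<Gamma>'"
  by (intro ext Gx_eqI) (simp add: koszul)

lemma levi_civita_bilinear:
  assumes "levi_civita \<Gamma>"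
  shows "bilinear \<Gamma>"
proof -
  have r: "linear (\<Gamma> u)" for u
  proof (rule linearI)
    show "\<Gamma> u (v + w) = \<Gamma> u v + \<Gamma> u w" for v w
      by (rule Gx_eqI)
        (simp add: koszul[OF assms] bilinear_ladd[OF Gx(1)] bilinear_ladd[OF dG_bilinear]
          bilinear_radd[OF dG_bilinear] linear_add[OF dG_linear] field_simps)
    show "\<Gamma> u (c *\<^sub>R v) = c *\<^sub>R \<Gamma> u v" for c v
      by (rule Gx_eqI)
        (simp add: koszul[OF assms] bilinear_lmul[OF Gx(1)] bilinear_lmul[OF dG_bilinear]
          bilinear_rmul[OF dG_bilinear] linear_scale[OF dG_linear] algebra_simps)
  qed
  moreover have "(\<lambda>u. \<Gamma> u v) = \<Gamma> v" for v using assms unfolding levi_civita_def by auto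
  ultimately show ?thesis unfolding bilinear_def by simp
qed

text \<open>The right-hand side of the Koszul formula is linear in \<open>w\<close>, so
  \<open>posdef_riesz\<close> turns it into a vector, which becomes
  \<open>\<Gamma> u v\<close>.\<close>

lemma levi_civita_exists: "\<exists>\<Gamma>. levi_civita \<Gamma>"
proof -
  define K where "K u v w = (dG u v w + dG v u w - dG w u v) / 2" for u v w
  have "linear (K u v)" for u v
    unfolding K_def
    by (rule linearI)
      (simp_all add: bilinear_radd[OF dG_bilinear] linear_add[OF dG_linear]
         bilinear_rmul[OF dG_bilinear] linear_scale[OF dG_linear] field_simps)
  then have "\<forall>u v. \<exists>\<gamma>. \<forall>w. G x \<gamma> w = K u v w"
    using posdef_riesz[OF Gx(1,3)] by blast
  then obtain \<Gamma> where \<Gamma>: "\<And>u v w. G x (\<Gamma> u v) w = K u v w" by metis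
  have "levi_civita \<Gamma>"
    unfolding levi_civita_def
  proof (intro conjI allI)
    show "\<Gamma> u v = \<Gamma> v u" for u v
      by (rule Gx_eqI) (simp add: \<Gamma> K_def dG_sym[of _ u v])
    show "frechet_derivative (\<lambda>y. G y v w) (at x) u = G x (\<Gamma> u v) w + G x v (\<Gamma> u w)" for u v w
    proof -
      have "G x v (\<Gamma> u w) = K u w v" using Gx(2)[of v "\<Gamma> u w"] \<Gamma> by simp
      then show ?thesis
        unfolding \<Gamma> K_def dG_def[symmetric] using dG_sym[of u w v] dG_sym[of v w u] dG_sym[of w u v]
        by (simp add: field_simps)
    qed
  qed
  then show ?thesis by blast
qed

end

section \<open>The trace on a subspace\<close>

text \<open>The chosen basis lies in \<open>V\<close>, so only values on \<open>V\<close> enter.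
  This allows a shape operator to be replaced by a map that is linear on the whole coordinate
  space.\<close>

lemma trace_on_cong:
  assumes "subspace V" "\<And>v. v \<in> V \<Longrightarrow> A v = A' v"
  shows "trace_on V A = trace_on V A'"
proof -
  define B where "B = (SOME B. independent B \<and> span B = V)"
  have "\<exists>B. independent B \<and> span B = V"
    using assms(1) by (metis basis_exists span_eq_iff span_subspace)
  then have "span B = V" unfolding B_def by (rule someI2_ex) simp
  then have "B \<subseteq> V" using span_superset by blast
  then show ?thesis
    unfolding trace_on_def Let_def B_def[symmetric] using assms(2) by (intro sum.cong) auto
qed

text \<open>Expand each \<open>b\<close> in the family \<open>e\<close>, then exchange the two sums:
  this is cyclicity of the trace. The family only has to reproduce \<open>V\<close>, independence is
  not assumed, and the basis picked in \<open>trace_on\<close> disappears.\<close>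

lemma trace_on_dual:
  fixes V :: "'e::euclidean_space set" and e :: "'k \<Rightarrow> 'e"
  assumes V: "subspace V" and A: "linear A" "A ` V \<subseteq> V"
    and e: "finite I" "\<And>i. i \<in> I \<Longrightarrow> e i \<in> V"
    and f: "\<And>i. i \<in> I \<Longrightarrow> linear (f i)" "\<And>v. v \<in> V \<Longrightarrow> v = (\<Sum>i\<in>I. f i v *\<^sub>R e i)"
  shows "trace_on V A = (\<Sum>i\<in>I. f i (A (e i)))"
proof -
  define B where "B = (SOME B. independent B \<and> span B = V)"
  have "\<exists>B. independent B \<and> span B = V"
    using V by (metis basis_exists span_eq_iff span_subspace)
  then have B: "independent B" "span B = V" unfolding B_def by (metis (mono_tags, lifting) someI_ex)+
  have BV: "B \<subseteq> V" using B(2) span_superset by blast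
  have fin: "finite B" using B(1) independent_imp_finite by blast
  have AV: "A (e i) \<in> span B" if "i \<in> I" for i using that e A(2) B(2) by blast
  have rep: "representation B (A b) b = (\<Sum>i\<in>I. f i b * representation B (A (e i)) b)" if "b \<in> B" for b
  proof -
    have "A b = A (\<Sum>i\<in>I. f i b *\<^sub>R e i)" using f(2) that BV by auto
    also have "\<dots> = (\<Sum>i\<in>I. f i b *\<^sub>R A (e i))" using A(1) by (simp add: linear_sum linear_scale)
    finally have "A b = (\<Sum>i\<in>I. f i b *\<^sub>R A (e i))" .
    then show ?thesis
      using AV B(1) by (simp add: representation_sum representation_scale span_scale)
  qed
  have "trace_on V A = (\<Sum>b\<in>B. \<Sum>i\<in>I. f i b * representation B (A (e i)) b)"
    unfolding trace_on_def Let_def B_def[symmetric] using rep by simp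
  also have "\<dots> = (\<Sum>i\<in>I. \<Sum>b\<in>B. f i b * representation B (A (e i)) b)" by (rule sum.swap)
  also have "\<dots> = (\<Sum>i\<in>I. f i (A (e i)))"
  proof (rule sum.cong)
    fix i assume i: "i \<in> I"
    have "f i (A (e i)) = f i (\<Sum>b\<in>B. representation B (A (e i)) b *\<^sub>R b)"
      using sum_representation_eq[OF B(1) AV[OF i] fin] by simp
    also have "\<dots> = (\<Sum>b\<in>B. representation B (A (e i)) b * f i b)"
      using f(1)[OF i] by (simp add: linear_sum linear_scale)
    finally show "(\<Sum>b\<in>B. f i b * representation B (A (e i)) b) = f i (A (e i))"
      by (simp add: mult.commute)
  qed simp
  finally show ?thesis .
qed

text \<open>Orthonormality refers to the Euclidean product of the coordinate space and not to the
  Riemannian metric; its purpose is to give explicit coefficient functionals.\<close>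

lemma orthonormal_expansion:
  fixes V :: "'e::euclidean_space set"
  assumes "subspace V"
  obtains B where "finite B" "B \<subseteq> V" "\<And>v. v \<in> V \<Longrightarrow> v = (\<Sum>b\<in>B. (v \<bullet> b) *\<^sub>R b)"
proof -
  obtain B where B: "B \<subseteq> V" "pairwise orthogonal B" "\<And>x. x \<in> B \<Longrightarrow> norm x = 1"
    "independent B" "span B = V"
    using orthonormal_basis_subspace[OF assms] by metis
  have fin: "finite B" using B(4) independent_imp_finite by blast
  show ?thesis
  proof (rule that[OF fin B(1)])
    show "v = (\<Sum>b\<in>B. (v \<bullet> b) *\<^sub>R b)" if "v \<in> V" for v
      using orthonormal_basis_expand[of B v] B fin that by simp
  qed
qed

lemma trace_on_orthonormal:
  fixes V :: "'e::euclidean_space set"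
  assumes "subspace V" "linear A" "A ` V \<subseteq> V"
    and "finite B" "B \<subseteq> V" "\<And>v. v \<in> V \<Longrightarrow> v = (\<Sum>b\<in>B. (v \<bullet> b) *\<^sub>R b)"
  shows "trace_on V A = (\<Sum>b\<in>B. A b \<bullet> b)"
  using trace_on_dual[OF assms(1-4), of id "\<lambda>b v. v \<bullet> b"] assms(5,6)
  by (auto simp: linear_iff inner_add_left)

text \<open>The rank-one map \<open>v \<mapsto> \<phi> v *\<^sub>R z\<close> has trace
  \<open>\<phi> z\<close>. The Lorentzian shape operator has this form, with \<open>z\<close> the
  height gradient.\<close>

lemma trace_on_rank_one_update:
  fixes V :: "'e::euclidean_space set"
  assumes "subspace V" "linear A" "A ` V \<subseteq> V" and \<phi>: "linear \<phi>" and z: "z \<in> V"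
  shows "trace_on V (\<lambda>v. c *\<^sub>R A v + \<phi> v *\<^sub>R z) = c * trace_on V A + \<phi> z"
proof -
  obtain B where B: "finite B" "B \<subseteq> V" "\<And>v. v \<in> V \<Longrightarrow> v = (\<Sum>b\<in>B. (v \<bullet> b) *\<^sub>R b)"
    using orthonormal_expansion[OF assms(1)] by blast
  have "linear (\<lambda>v. c *\<^sub>R A v + \<phi> v *\<^sub>R z)"
    using assms(2) \<phi> by (intro linearI) (simp_all add: linear_add linear_scale algebra_simps)
  moreover have "(\<lambda>v. c *\<^sub>R A v + \<phi> v *\<^sub>R z) ` V \<subseteq> V"
    using assms(1,3) z by (auto simp: subspace_scale subspace_add image_subset_iff)
  ultimately have "trace_on V (\<lambda>v. c *\<^sub>R A v + \<phi> v *\<^sub>R z) = (\<Sum>b\<in>B. (c *\<^sub>R A b + \<phi> b *\<^sub>R z) \<bullet> b)"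
    using trace_on_orthonormal[OF assms(1) _ _ B] by blast
  also have "\<dots> = c * (\<Sum>b\<in>B. A b \<bullet> b) + (\<Sum>b\<in>B. (z \<bullet> b) * \<phi> b)"
    by (simp add: inner_add_left sum.distrib sum_distrib_left mult.commute)
  also have "(\<Sum>b\<in>B. (z \<bullet> b) * \<phi> b) = \<phi> (\<Sum>b\<in>B. (z \<bullet> b) *\<^sub>R b)"
    using \<phi> by (simp add: linear_sum linear_scale)
  finally show ?thesis
    using trace_on_orthonormal[OF assms(1-3) B] B(3)[OF z] by simp
qed

lemma trace_on_scaleR:
  fixes V :: "'e::euclidean_space set"
  assumes "subspace V" "linear A" "A ` V \<subseteq> V"
  shows "trace_on V (\<lambda>v. c *\<^sub>R A v) = c * trace_on V A"
  using trace_on_rank_one_update[OF assms linear_zero, of 0 c] subspace_0[OF assms(1)] by simp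

text \<open>The trace by blocks of \<open>V = j V0 + span {z}\<close>: \<open>q\<close> and
  \<open>l\<close> are the coordinates of this splitting, and the first block is the compression of
  \<open>A\<close> to \<open>V0\<close>. In the application \<open>j\<close> embeds the tangent
  space of a section and \<open>z\<close> is the height gradient.\<close>

lemma trace_on_split:
  fixes V0 :: "'e::euclidean_space set" and V :: "'f::euclidean_space set"
  assumes V: "subspace V0" "subspace V" and A: "linear A" "A ` V \<subseteq> V"
    and lin: "linear j" "linear q" "linear l"
    and j: "\<And>u. u \<in> V0 \<Longrightarrow> j u \<in> V" and z: "z \<in> V"
    and q: "\<And>v. v \<in> V \<Longrightarrow> q v \<in> V0" "\<And>v. v \<in> V \<Longrightarrow> v = j (q v) + l v *\<^sub>R z"
  shows "trace_on V A = trace_on V0 (\<lambda>u. q (A (j u))) + l (A z)"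
proof -
  obtain B where B: "finite B" "B \<subseteq> V0" "\<And>v. v \<in> V0 \<Longrightarrow> v = (\<Sum>b\<in>B. (v \<bullet> b) *\<^sub>R b)"
    using orthonormal_expansion[OF V(1)] by blast
  have linqAj: "linear (\<lambda>u. q (A (j u)))"
    using linear_compose[OF linear_compose[OF lin(1) A(1)] lin(2)] by (simp add: o_def)
  \<comment> \<open>The index type \<open>option\<close> keeps \<open>z\<close> separate from the
    vectors \<open>j b\<close>, so no distinctness has to be shown.\<close>
  define e where "e i = (case i of None \<Rightarrow> z | Some b \<Rightarrow> j b)" for i
  define f where "f i v = (case i of None \<Rightarrow> l v | Some b \<Rightarrow> q v \<bullet> b)" for i v
  let ?I = "insert None (Some ` B)"
  have sumI: "(\<Sum>i\<in>?I. g i) = g None + (\<Sum>b\<in>B. g (Some b))" for g :: "'e option \<Rightarrow> 'c::comm_monoid_add"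
    using B(1) by (subst sum.insert) (auto simp: sum.reindex)
  have "trace_on V A = (\<Sum>i\<in>?I. f i (A (e i)))"
  proof (rule trace_on_dual[OF V(2) A])
    show "finite ?I" using B(1) by simp
    show "e i \<in> V" if "i \<in> ?I" for i using that j z B(2) by (auto simp: e_def)
    show "linear (f i)" for i
      using lin by (cases i) (auto simp: f_def linear_iff inner_add_left)
    show "v = (\<Sum>i\<in>?I. f i v *\<^sub>R e i)" if v: "v \<in> V" for v
    proof -
      have "j (q v) = j (\<Sum>b\<in>B. (q v \<bullet> b) *\<^sub>R b)" using B(3)[OF q(1)[OF v]] by simp
      also have "\<dots> = (\<Sum>b\<in>B. (q v \<bullet> b) *\<^sub>R j b)" using lin(1) by (simp add: linear_sum linear_scale)
      finally show ?thesis unfolding sumI using q(2)[OF v] by (simp add: e_def f_def add.commute)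
    qed
  qed
  also have "\<dots> = l (A z) + (\<Sum>b\<in>B. q (A (j b)) \<bullet> b)" unfolding sumI by (simp add: e_def f_def)
  also have "(\<Sum>b\<in>B. q (A (j b)) \<bullet> b) = trace_on V0 (\<lambda>u. q (A (j u)))"
    using trace_on_orthonormal[OF V(1) linqAj _ B] j A(2) q(1) by (simp add: image_subset_iff)
  finally show ?thesis by simp
qed

section \<open>Hypersurfaces of a Riemannian manifold\<close>

locale riemannian =
  fixes P :: "('i, 'm::{t2_space,second_countable_topology}, 'e::euclidean_space) manifold_data"
  assumes P: "riemannian_manifold P"
begin

section \<open>Charts and the metric in coordinates\<close>

lemma chart_at: "p \<in> cdom P (chart_at P p)"
proof -
  have "\<exists>i. p \<in> cdom P i" using P unfolding riemannian_manifold_def smooth_atlas_def by blast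
  then show ?thesis unfolding chart_at_def by (rule someI_ex)
qed

lemma chart_homeomorphism: "homeomorphism (cdom P i) (cmap P i ` cdom P i) (cmap P i) (cinv P i)"
  using P unfolding riemannian_manifold_def smooth_atlas_def by blast

lemma open_cdom: "open (cdom P i)" and open_cmap_cdom: "open (cmap P i ` cdom P i)"
  using P unfolding riemannian_manifold_def smooth_atlas_def by blast+

lemma open_cmap:
  assumes "open W"
  shows "open (cmap P i ` (W \<inter> cdom P i))"
proof -
  have "openin (top_of_set (cdom P i)) (W \<inter> cdom P i)"
    using openin_open_Int[OF assms, of "cdom P i"] by (simp add: Int_commute)
  from homeomorphism_imp_open_map[OF chart_homeomorphism this] show ?thesis
    using openin_open_trans open_cmap_cdom by blast
qed

lemma cinv_cmap [simp]: "q \<in> cdom P i \<Longrightarrow> cinv P i (cmap P i q) = q"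
  using chart_homeomorphism unfolding homeomorphism_def by blast

lemma cmap_eq_iff: "q \<in> cdom P i \<Longrightarrow> q' \<in> cdom P i \<Longrightarrow> cmap P i q = cmap P i q' \<longleftrightarrow> q = q'"
  using cinv_cmap by metis

lemma smooth_change_coords:
  "smooth_on (cmap P i ` (cdom P i \<inter> cdom P j)) (change_coords P i j)"
  using P unfolding riemannian_manifold_def smooth_atlas_def by blast

lemma coords_has_derivative:
  assumes "q \<in> cdom P i"
  shows "(change_coords P (chart_at P q) i has_derivative coords P i q) (at (cmap P (chart_at P q) q))"
proof -
  have "coords P i q = frechet_derivative (change_coords P (chart_at P q) i) (at (cmap P (chart_at P q) q))"
    by (rule ext) (simp add: coords_def)
  then show ?thesis
    using smooth_on_has_derivative[OF smooth_change_coords] assms chart_at by simp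
qed

lemma coords_linear: "q \<in> cdom P i \<Longrightarrow> linear (coords P i q)"
  using has_derivative_linear[OF coords_has_derivative] .

text \<open>The change from a chart to itself is the identity on the image of the chart, and
  openness of this image transfers that to the derivative.\<close>

lemma coords_own [simp]: "coords P (chart_at P p) p v = v"
proof -
  let ?k = "chart_at P p"
  have "change_coords P ?k ?k y = id y" if "y \<in> cmap P ?k ` cdom P ?k" for y
    using that by (auto simp: change_coords_def)
  then have "(id has_derivative coords P ?k p) (at (cmap P ?k p))"
    using has_derivative_cong_open[OF open_cmap_cdom, of "cmap P ?k p" ?k "change_coords P ?k ?k" id]
      coords_has_derivative[OF chart_at] chart_at by blast
  then have "coords P ?k p = id"
    using has_derivative_unique has_derivative_id by (metis eq_id_iff)
  then show ?thesis by simp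
qed

lemma local_metric: "p \<in> cdom P i \<Longrightarrow> local_metric (metric P i) (cmap P i ` cdom P i) (cmap P i p)"
proof
  show "open (cmap P i ` cdom P i)" by (rule open_cmap_cdom)
  assume p: "p \<in> cdom P i"
  then show "cmap P i p \<in> cmap P i ` cdom P i" by simp
  show "(\<lambda>y. metric P i y u v) differentiable at (cmap P i p)" for u v
  proof -
    have "smooth_on (cmap P i ` cdom P i) (\<lambda>y. metric P i y u v)"
      using P unfolding riemannian_manifold_def riemannian_metric_def by blast
    then show ?thesis using smooth_on_has_derivative p unfolding differentiable_def by blast
  qed
qed (use P in \<open>unfold riemannian_manifold_def riemannian_metric_def, blast+\<close>)

lemma christoffel:
  assumes "p \<in> cdom P i"
  shows "local_metric.levi_civita (metric P i) (cmap P i p) (christoffel P i (cmap P i p))"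
proof -
  interpret local_metric "metric P i" "cmap P i ` cdom P i" "cmap P i p"
    by (rule local_metric[OF assms])
  have "christoffel P i (cmap P i p) = (THE \<Gamma>. levi_civita \<Gamma>)"
    unfolding christoffel_def levi_civita_def by simp
  moreover obtain \<Gamma> where "levi_civita \<Gamma>" using levi_civita_exists by blast
  ultimately show ?thesis using theI[of levi_civita \<Gamma>] levi_civita_unique by metis
qed

lemma christoffel_bilinear: "p \<in> cdom P i \<Longrightarrow> bilinear (christoffel P i (cmap P i p))"
  using local_metric.levi_civita_bilinear[OF local_metric christoffel] .

text \<open>\<open>inner_at\<close> uses the preferred chart of \<open>q\<close>, which varies with
  \<open>q\<close> without any regularity. Compatibility of the metric with coordinate changes lets
  a whole neighbourhood be treated in one chart.\<close>

lemma inner_at_chart: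
  assumes "q \<in> cdom P i"
  shows "inner_at P q u v = metric P i (cmap P i q) (coords P i q u) (coords P i q v)"
proof -
  have "q \<in> cdom P (chart_at P q) \<inter> cdom P i" using assms chart_at by blast
  moreover have "\<forall>i j. \<forall>p\<in>cdom P i \<inter> cdom P j. \<forall>u v.
        metric P i (cmap P i p) u v =
          metric P j (cmap P j p)
            (frechet_derivative (change_coords P i j) (at (cmap P i p)) u)
            (frechet_derivative (change_coords P i j) (at (cmap P i p)) v)"
    using P unfolding riemannian_manifold_def riemannian_metric_def by blast
  ultimately show ?thesis unfolding inner_at_def coords_def by blast
qed

lemma inner_at_eq: "inner_at P p = metric P (chart_at P p) (cmap P (chart_at P p) p)"
  by (intro ext) (simp add: inner_at_def)

lemma inner_at_bilinear: "bilinear (inner_at P p)"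
  and inner_at_sym: "inner_at P p u v = inner_at P p v u"
  and inner_at_pos: "u \<noteq> 0 \<Longrightarrow> 0 < inner_at P p u u"
proof -
  interpret local_metric "metric P (chart_at P p)" "cmap P (chart_at P p) ` cdom P (chart_at P p)"
    "cmap P (chart_at P p) p"
    by (rule local_metric[OF chart_at])
  show "bilinear (inner_at P p)" "inner_at P p u v = inner_at P p v u"
    "u \<noteq> 0 \<Longrightarrow> 0 < inner_at P p u u"
    using Gx by (simp_all add: inner_at_eq)
qed

lemma inner_at_eq_0: "inner_at P p u u = 0 \<Longrightarrow> u = 0"
  using inner_at_pos less_irrefl by metis

lemmas inner_at_simps =
  bilinear_ladd[OF inner_at_bilinear] bilinear_radd[OF inner_at_bilinear]
  bilinear_lsub[OF inner_at_bilinear] bilinear_rsub[OF inner_at_bilinear]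
  bilinear_lmul[OF inner_at_bilinear] bilinear_rmul[OF inner_at_bilinear]
  bilinear_lneg[OF inner_at_bilinear] bilinear_rneg[OF inner_at_bilinear]
  bilinear_lzero[OF inner_at_bilinear] bilinear_rzero[OF inner_at_bilinear]

section \<open>Tangent spaces of hypersurfaces\<close>

lemma tangent_space_velocities:
  "tangent_space P S p =
     velocities (cmap P (chart_at P p) p) (cmap P (chart_at P p) ` (S \<inter> cdom P (chart_at P p)))"
proof -
  define k where "k = chart_at P p"
  have p: "p \<in> cdom P k" unfolding k_def by (rule chart_at)
  have "v \<in> tangent_space P S p \<longleftrightarrow> v \<in> velocities (cmap P k p) (cmap P k ` (S \<inter> cdom P k))" for v
  proof
    assume "v \<in> tangent_space P S p"
    then obtain \<gamma> where \<gamma>: "\<gamma> 0 = p" "\<forall>\<^sub>F s in at (0::real). \<gamma> s \<in> S \<inter> cdom P k"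
      "((\<lambda>s. cmap P k (\<gamma> s)) has_vector_derivative v) (at 0)"
      unfolding tangent_space_def k_def by blast
    then show "v \<in> velocities (cmap P k p) (cmap P k ` (S \<inter> cdom P k))"
      unfolding velocities_def
      by (intro CollectI exI[of _ "\<lambda>s. cmap P k (\<gamma> s)"]) (auto elim!: eventually_mono)
  next
    assume "v \<in> velocities (cmap P k p) (cmap P k ` (S \<inter> cdom P k))"
    then obtain c where c: "c 0 = cmap P k p" "\<forall>\<^sub>F s in at (0::real). c s \<in> cmap P k ` (S \<inter> cdom P k)"
      "(c has_vector_derivative v) (at 0)"
      unfolding velocities_def by blast
    define \<gamma> where "\<gamma> s = cinv P k (c s)" for s
    have ev: "\<forall>\<^sub>F s in at 0. \<gamma> s \<in> S \<inter> cdom P k \<and> c s = cmap P k (\<gamma> s)"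
      using c(2) by eventually_elim (auto simp: \<gamma>_def)
    have "c 0 = cmap P k (\<gamma> 0)" using c(1) p by (simp add: \<gamma>_def)
    then have "((\<lambda>s. cmap P k (\<gamma> s)) has_vector_derivative v) (at 0)"
      using c(3) ev unfolding has_vector_derivative_def
      by (elim has_derivative_transform_eventually) (auto elim: eventually_mono)
    moreover have "\<gamma> 0 = p" using c(1) p by (simp add: \<gamma>_def)
    moreover have "\<forall>\<^sub>F s in at 0. \<gamma> s \<in> S \<inter> cdom P k" using ev by (auto elim: eventually_mono)
    ultimately show "v \<in> tangent_space P S p"
      unfolding tangent_space_def k_def by blast
  qed
  then show ?thesis unfolding k_def by blast
qed

lemma tangent_space_Int:
  assumes "open W" "p \<in> W"
  shows "tangent_space P (S \<inter> W) p = tangent_space P S p"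
proof -
  define k where "k = chart_at P p"
  have p: "p \<in> cdom P k" unfolding k_def by (rule chart_at)
  let ?U = "cmap P k ` (W \<inter> cdom P k)"
  have U: "open ?U" "cmap P k p \<in> ?U" using open_cmap[OF assms(1)] assms(2) p by auto
  have "cmap P k ` (S \<inter> cdom P k) \<inter> ?U \<subseteq> cmap P k ` (S \<inter> W \<inter> cdom P k)"
    using cmap_eq_iff by blast
  moreover have "cmap P k ` (S \<inter> W \<inter> cdom P k) \<inter> ?U \<subseteq> cmap P k ` (S \<inter> cdom P k)" by blast
  ultimately show ?thesis
    unfolding tangent_space_velocities k_def[symmetric] using velocities_germ[OF _ U] by blast
qed

lemma tangent_space_level_set:
  assumes W: "open W" and h: "smooth_function_on P W h" and SW: "S \<inter> W = {q \<in> W. h q = 0}"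
    and pS: "p \<in> S \<inter> W" and w: "differential P h p w \<noteq> 0"
  shows "linear (differential P h p)" "tangent_space P S p = {v. differential P h p v = 0}"
proof -
  define k where "k = chart_at P p"
  have p: "p \<in> cdom P k" unfolding k_def by (rule chart_at)
  define U where "U = cmap P k ` (W \<inter> cdom P k)"
  define g where "g = h \<circ> cinv P k"
  have U: "open U" "cmap P k p \<in> U" unfolding U_def using open_cmap[OF W] pS p by auto
  have g: "smooth_on U g" using h unfolding smooth_function_on_def U_def g_def by blast
  have g': "(g has_derivative differential P h p) (at (cmap P k p))"
    using smooth_on_has_derivative[OF g U(2)] unfolding differential_def g_def k_def .
  then show "linear (differential P h p)" by (rule has_derivative_linear)
  have "g (cmap P k p) = 0" using pS SW p by (auto simp: g_def)
  moreover have "cmap P k ` (S \<inter> cdom P k) \<inter> U = {y \<in> U. g y = 0}"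
  proof (intro equalityI subsetI)
    fix y assume "y \<in> cmap P k ` (S \<inter> cdom P k) \<inter> U"
    then obtain q where q: "q \<in> S" "q \<in> cdom P k" "y = cmap P k q" "y \<in> U" by blast
    then have "q \<in> W" unfolding U_def using cmap_eq_iff by blast
    then show "y \<in> {y \<in> U. g y = 0}" using q SW by (auto simp: g_def)
  next
    fix y assume "y \<in> {y \<in> U. g y = 0}"
    then show "y \<in> cmap P k ` (S \<inter> cdom P k) \<inter> U" using SW by (auto simp: g_def U_def)
  qed
  ultimately show "tangent_space P S p = {v. differential P h p v = 0}"
    unfolding tangent_space_velocities k_def[symmetric]
    using velocities_level_set[OF U smooth_on_continuous_on[OF g] g' _ w] by blast
qed

lemma tangent_space_hypersurface:
  assumes S: "hypersurface P S" "p \<in> S"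
  obtains \<phi> :: "'e \<Rightarrow> real" where "linear \<phi>" "\<exists>w. \<phi> w \<noteq> 0" "tangent_space P S p = {v. \<phi> v = 0}"
proof -
  obtain W h where W: "open W" "p \<in> S \<inter> W" and h: "smooth_function_on P W h"
    and SW: "S \<inter> W = {q \<in> W. h q = 0}" and d: "\<forall>q\<in>S \<inter> W. \<exists>v. differential P h q v \<noteq> 0"
    using S unfolding hypersurface_def by blast
  then obtain w where w: "differential P h p w \<noteq> 0" by blast
  show ?thesis
    using that[of "differential P h p"] tangent_space_level_set[OF W(1) h SW W(2) w] w by blast
qed

text \<open>\<open>unit_normal\<close> gives only one inclusion. For the other, the tangent space is
  the orthogonal complement of some \<open>n\<close>; the part of \<open>N p\<close> orthogonal to
  \<open>n\<close> is tangent, hence orthogonal to \<open>N p\<close> as well, and so vanishes. Thus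
  \<open>N p\<close> is a nonzero multiple of \<open>n\<close>.\<close>

lemma tangent_space_normal:
  assumes S: "hypersurface P S" "unit_normal P S N" "p \<in> S"
  shows "tangent_space P S p = {v. inner_at P p (N p) v = 0}"
proof -
  obtain \<phi> :: "'e \<Rightarrow> real" where \<phi>: "linear \<phi>" "\<exists>w. \<phi> w \<noteq> 0" and T: "tangent_space P S p = {v. \<phi> v = 0}"
    by (rule tangent_space_hypersurface[OF S(1,3)])
  obtain n where n: "\<And>z. inner_at P p n z = \<phi> z"
    using posdef_riesz[OF inner_at_bilinear inner_at_pos \<phi>(1)] by blast
  have orth: "inner_at P p (N p) v = 0" if "\<phi> v = 0" for v
    using S(2,3) T that unfolding unit_normal_def by blast
  have unit: "inner_at P p (N p) (N p) = 1" using S(2,3) unfolding unit_normal_def by blast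
  have "n \<noteq> 0" using \<phi>(2) n inner_at_simps(9) by metis
  then have nn: "inner_at P p n n > 0" using inner_at_pos by blast
  define c where "c = inner_at P p n (N p) / inner_at P p n n"
  define d where "d = N p - c *\<^sub>R n"
  have "inner_at P p n d = 0" using nn by (simp add: d_def c_def inner_at_simps)
  then have "inner_at P p (N p) d = 0" using orth n by simp
  moreover have "inner_at P p d d = inner_at P p (N p) d - c * inner_at P p n d"
    by (simp add: d_def inner_at_simps algebra_simps)
  ultimately have "inner_at P p d d = 0" using \<open>inner_at P p n d = 0\<close> by simp
  then have "d = 0" by (rule inner_at_eq_0)
  then have N: "N p = c *\<^sub>R n" by (simp add: d_def)
  then have "c \<noteq> 0" using unit by (auto simp: inner_at_simps)
  then show ?thesis unfolding T using n N by (auto simp: inner_at_simps)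
qed

lemma subspace_tangent_space:
  assumes "hypersurface P S" "p \<in> S"
  shows "subspace (tangent_space P S p)"
proof -
  obtain \<phi> :: "'e \<Rightarrow> real" where \<phi>: "linear \<phi>" "\<exists>w. \<phi> w \<noteq> 0"
    and T: "tangent_space P S p = {v. \<phi> v = 0}"
    by (rule tangent_space_hypersurface[OF assms])
  show ?thesis unfolding T by (rule linear_subspace_kernel[OF \<phi>(1)])
qed

section \<open>Covariant derivatives through local extensions\<close>

text \<open>Differentiability of \<open>F\<close> at the one point is all that a first covariant
  derivative uses. This makes extensions of derived fields, such as the normal of a section, easy to
  produce.\<close>

definition local_extension :: "'m set \<Rightarrow> 'm \<Rightarrow> ('m \<Rightarrow> 'e) \<Rightarrow> ('e \<Rightarrow> 'e) \<Rightarrow> ('e \<Rightarrow> 'e) \<Rightarrow> bool" where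
  "local_extension S p V F F' \<longleftrightarrow>
     (\<exists>U. open U \<and> cmap P (chart_at P p) p \<in> U \<and>
       (\<forall>q\<in>S \<inter> cdom P (chart_at P p). cmap P (chart_at P p) q \<in> U \<longrightarrow>
          F (cmap P (chart_at P p) q) = coords P (chart_at P p) q (V q))) \<and>
     (F has_derivative F') (at (cmap P (chart_at P p) p))"

lemma local_extension_at:
  "local_extension S p V F F' \<Longrightarrow> p \<in> S \<Longrightarrow> F (cmap P (chart_at P p) p) = V p"
  unfolding local_extension_def using chart_at by fastforce

lemma local_extension_exists:
  assumes "smooth_field_along P S V" "p \<in> S"
  obtains F F' where "local_extension S p V F F'"
proof -
  obtain U F where U: "open U" "cmap P (chart_at P p) p \<in> U" and F: "smooth_on U F"
    "\<forall>q\<in>S \<inter> cdom P (chart_at P p). cmap P (chart_at P p) q \<in> U \<longrightarrow>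
       F (cmap P (chart_at P p) q) = coords P (chart_at P p) q (V q)"
    using assms chart_at unfolding smooth_field_along_def by meson
  then show ?thesis
    using that smooth_on_has_derivative[OF F(1) U(2)] unfolding local_extension_def by blast
qed

lemma deriv_along_eq:
  assumes p: "p \<in> S" and X: "X \<in> tangent_space P S p"
    and U: "open U" "cmap P (chart_at P p) p \<in> U"
      "\<And>q. q \<in> S \<Longrightarrow> q \<in> cdom P (chart_at P p) \<Longrightarrow> cmap P (chart_at P p) q \<in> U \<Longrightarrow>
         F (cmap P (chart_at P p) q) = f q"
    and F: "(F has_derivative F') (at (cmap P (chart_at P p) p))"
  shows "deriv_along P S f p X = F' X"
  unfolding deriv_along_def
proof (rule frechet_derivative_within_velocity[OF _ F U(1,2)])
  show "X \<in> velocities (cmap P (chart_at P p) p) (cmap P (chart_at P p) ` (S \<inter> cdom P (chart_at P p)))"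
    using X tangent_space_velocities by blast
  show "cmap P (chart_at P p) p \<in> cmap P (chart_at P p) ` (S \<inter> cdom P (chart_at P p))"
    using p chart_at by blast
  show "(f \<circ> cinv P (chart_at P p)) y = F y"
    if "y \<in> cmap P (chart_at P p) ` (S \<inter> cdom P (chart_at P p)) \<inter> U" for y
    using that U(3) by auto
qed

lemma cov_deriv_eq:
  assumes "p \<in> S" "X \<in> tangent_space P S p" "local_extension S p V F F'"
  shows "cov_deriv P S V p X =
    F' X + christoffel P (chart_at P p) (cmap P (chart_at P p) p) X (V p)"
proof -
  obtain U where U: "open U" "cmap P (chart_at P p) p \<in> U"
    "\<forall>q\<in>S \<inter> cdom P (chart_at P p). cmap P (chart_at P p) q \<in> U \<longrightarrow>
       F (cmap P (chart_at P p) q) = coords P (chart_at P p) q (V q)"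
    and F: "(F has_derivative F') (at (cmap P (chart_at P p) p))"
    using assms(3) unfolding local_extension_def by blast
  have "deriv_along P S (\<lambda>q. coords P (chart_at P p) q (V q)) p X = F' X"
    by (rule deriv_along_eq[OF assms(1,2) U(1,2) _ F]) (use U(3) in blast)
  then show ?thesis unfolding cov_deriv_def by simp
qed

text \<open>Differentiate \<open>\<langle>N, N\<rangle> = 1\<close>; compatibility of the connection
  gathers the terms into twice the product of \<open>N\<close> with its covariant derivative. The
  extended function is constant on \<open>S\<close> only, so its derivative is shown to vanish on
  velocities.\<close>

lemma cov_deriv_unit_normal:
  assumes S: "hypersurface P S" "unit_normal P S N" "p \<in> S" and X: "X \<in> tangent_space P S p"
  shows "inner_at P p (N p) (cov_deriv P S N p X) = 0"
proof -
  define k where "k = chart_at P p"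
  define x where "x = cmap P k p"
  have p: "p \<in> cdom P k" unfolding k_def by (rule chart_at)
  interpret local_metric "metric P k" "cmap P k ` cdom P k" x
    unfolding x_def by (rule local_metric[OF p])
  obtain F F' where ext: "local_extension S p N F F'"
    using local_extension_exists S(2,3) unfolding unit_normal_def by blast
  obtain U where U: "open U" "x \<in> U"
    "\<And>q. q \<in> S \<Longrightarrow> q \<in> cdom P k \<Longrightarrow> cmap P k q \<in> U \<Longrightarrow> F (cmap P k q) = coords P k q (N q)"
    and F: "(F has_derivative F') (at x)"
    using ext unfolding local_extension_def k_def[symmetric] x_def[symmetric] by blast
  have Fx: "F x = N p" using local_extension_at[OF ext S(3)] unfolding x_def k_def .
  let ?G = "christoffel P k x"
  have lc: "levi_civita ?G" unfolding x_def by (rule christoffel[OF p])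
  have "dG X (F x) (F x) + metric P k x (F' X) (F x) + metric P k x (F x) (F' X) = 0"
  proof (rule velocity_derivative_unique[where g = "\<lambda>_. 1" and g' = "\<lambda>_. 0"
        and f = "\<lambda>y. metric P k y (F y) (F y)"
        and f' = "\<lambda>X. dG X (F x) (F x) + metric P k x (F' X) (F x) + metric P k x (F x) (F' X)"])
    show "X \<in> velocities x (cmap P k ` (S \<inter> cdom P k))"
      using X tangent_space_velocities unfolding x_def k_def by blast
    show "metric P k y (F y) (F y) = 1" if "y \<in> cmap P k ` (S \<inter> cdom P k) \<inter> U" for y
    proof -
      obtain q where q: "q \<in> S" "q \<in> cdom P k" "y = cmap P k q" "cmap P k q \<in> U" using \<open>y \<in> _\<close> by blast
      have "inner_at P q (N q) (N q) = 1" using S(2) q(1) unfolding unit_normal_def by blast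
      then show ?thesis using inner_at_chart[OF q(2)] U(3)[OF q(1,2,4)] q(3) by simp
    qed
    show "x \<in> cmap P k ` (S \<inter> cdom P k)" using p S(3) unfolding x_def by blast
    show "((\<lambda>y. metric P k y (F y) (F y)) has_derivative
       (\<lambda>X. dG X (F x) (F x) + metric P k x (F' X) (F x) + metric P k x (F x) (F' X)))
        (at x within cmap P k ` (S \<inter> cdom P k))"
      by (rule has_derivative_at_withinI[OF has_derivative_metric[OF F F]])
  qed (use U in auto)
  moreover have "dG X (N p) (N p) = metric P k x (?G X (N p)) (N p) + metric P k x (N p) (?G X (N p))"
    using lc unfolding levi_civita_def dG_def by blast
  moreover have "cov_deriv P S N p X = F' X + ?G X (N p)"
    using cov_deriv_eq[OF S(3) X ext] unfolding x_def k_def .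
  ultimately have "2 * metric P k x (N p) (cov_deriv P S N p X) = 0"
    unfolding Fx using Gx(2)[of "F' X" "N p"] Gx(2)[of "?G X (N p)" "N p"]
    by (simp add: bilinear_radd[OF Gx(1)])
  then show ?thesis unfolding inner_at_def x_def k_def by simp
qed

text \<open>The trace lemmas ask for a map linear on the whole coordinate space. An ambient
  extension of \<open>N\<close> provides one that agrees with the shape operator on tangent
  vectors.\<close>

lemma shape_operator_linear:
  assumes S: "hypersurface P S" "unit_normal P S N" "p \<in> S" and ext: "local_extension S p N F F'"
  defines "A \<equiv> \<lambda>X. - (F' X + christoffel P (chart_at P p) (cmap P (chart_at P p) p) X (N p))"
  shows "linear A" "A ` tangent_space P S p \<subseteq> tangent_space P S p"
    "\<And>X. X \<in> tangent_space P S p \<Longrightarrow> shape_operator P S N p X = A X"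
proof -
  have "linear F'" using ext has_derivative_linear unfolding local_extension_def by blast
  moreover have "linear (\<lambda>X. christoffel P (chart_at P p) (cmap P (chart_at P p) p) X (N p))"
    using christoffel_bilinear[OF chart_at] unfolding bilinear_def by blast
  ultimately show "linear A" unfolding A_def by (intro linear_compose_neg linear_compose_add)
  show eq: "shape_operator P S N p X = A X" if "X \<in> tangent_space P S p" for X
    unfolding shape_operator_def A_def using cov_deriv_eq[OF S(3) that ext] by simp
  show "A ` tangent_space P S p \<subseteq> tangent_space P S p"
  proof (rule image_subsetI)
    fix X assume X: "X \<in> tangent_space P S p"
    have "inner_at P p (N p) (A X) = 0"
      using cov_deriv_unit_normal[OF S X] unfolding eq[OF X, symmetric] shape_operator_def
      by (simp add: inner_at_simps)
    then show "A X \<in> tangent_space P S p" using tangent_space_normal[OF S] by blast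
  qed
qed

section \<open>Independence of minimality from the unit normal\<close>

lemma unit_normal_sign:
  assumes S: "hypersurface P S" "unit_normal P S N" and W: "open W" "unit_normal P (S \<inter> W) N'"
    and q: "q \<in> S \<inter> W"
  defines "\<sigma> \<equiv> inner_at P q (N' q) (N q)"
  shows "N' q = \<sigma> *\<^sub>R N q" "\<sigma> * \<sigma> = 1"
proof -
  define d where "d = N' q - \<sigma> *\<^sub>R N q"
  have N: "inner_at P q (N q) (N q) = 1" using S(2) q unfolding unit_normal_def by blast
  have N': "inner_at P q (N' q) (N' q) = 1" "\<forall>X\<in>tangent_space P (S \<inter> W) q. inner_at P q (N' q) X = 0"
    using W(2) q unfolding unit_normal_def by blast+
  have "inner_at P q (N q) d = 0"
    using N inner_at_sym[of q "N q" "N' q"] by (simp add: d_def \<sigma>_def inner_at_simps)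
  then have "d \<in> tangent_space P S q" using tangent_space_normal[OF S] q by blast
  then have "inner_at P q (N' q) d = 0" using N'(2) tangent_space_Int[OF W(1)] q by blast
  moreover have "inner_at P q d d = inner_at P q (N' q) d - \<sigma> * inner_at P q (N q) d"
    by (simp add: d_def inner_at_simps algebra_simps)
  ultimately have "inner_at P q d d = 0" using \<open>inner_at P q (N q) d = 0\<close> by simp
  then have "d = 0" by (rule inner_at_eq_0)
  then show *: "N' q = \<sigma> *\<^sub>R N q" by (simp add: d_def)
  show "\<sigma> * \<sigma> = 1" using N N'(1) unfolding * by (simp add: inner_at_simps)
qed

text \<open>Two unit normals differ by a factor 1 or -1. By continuity the factor is constant near
  \<open>p\<close>, so a constant multiple of an extension of \<open>N\<close> extends
  \<open>N'\<close> and the sign contributes no derivative.\<close>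

lemma cov_deriv_sign:
  assumes S: "hypersurface P S" "unit_normal P S N" and W: "open W" "unit_normal P (S \<inter> W) N'"
    and p: "p \<in> S \<inter> W"
  obtains \<sigma> where "\<sigma> * \<sigma> = 1"
    "\<And>X. X \<in> tangent_space P S p \<Longrightarrow> cov_deriv P (S \<inter> W) N' p X = \<sigma> *\<^sub>R cov_deriv P S N p X"
proof -
  define k where "k = chart_at P p"
  define x where "x = cmap P k p"
  have pk: "p \<in> cdom P k" unfolding k_def by (rule chart_at)
  interpret local_metric "metric P k" "cmap P k ` cdom P k" x
    unfolding x_def by (rule local_metric[OF pk])
  obtain F F' where ext: "local_extension S p N F F'"
    using local_extension_exists S(2) p unfolding unit_normal_def by blast
  obtain H H' where ext': "local_extension (S \<inter> W) p N' H H'"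
    using local_extension_exists W(2) p unfolding unit_normal_def by blast
  obtain U where U: "open U" "x \<in> U"
    "\<And>q. q \<in> S \<Longrightarrow> q \<in> cdom P k \<Longrightarrow> cmap P k q \<in> U \<Longrightarrow> F (cmap P k q) = coords P k q (N q)"
    and F: "(F has_derivative F') (at x)"
    using ext unfolding local_extension_def k_def[symmetric] x_def[symmetric] by blast
  obtain U' where U': "open U'" "x \<in> U'"
    "\<And>q. q \<in> S \<inter> W \<Longrightarrow> q \<in> cdom P k \<Longrightarrow> cmap P k q \<in> U' \<Longrightarrow> H (cmap P k q) = coords P k q (N' q)"
    and H: "(H has_derivative H') (at x)"
    using ext' unfolding local_extension_def k_def[symmetric] x_def[symmetric] by blast
  \<comment> \<open>\<open>g\<close> continues the sign function off \<open>S\<close>. Within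
    distance 1 of \<open>g x\<close> the opposite sign is out of reach, being 2 away.\<close>
  define g where "g y = metric P k y (H y) (F y)" for y
  have "isCont g x"
    unfolding g_def using has_derivative_metric[OF H F] has_derivative_continuous by blast
  then have "\<forall>\<^sub>F y in nhds x. dist (g y) (g x) < 1"
    using tendstoD[of g "g x" "nhds x" 1] by (simp add: isCont_def tendsto_at_iff_tendsto_nhds)
  then obtain U0 where U0: "open U0" "x \<in> U0" "\<And>y. y \<in> U0 \<Longrightarrow> dist (g y) (g x) < 1"
    unfolding eventually_nhds by blast
  define \<sigma> where "\<sigma> q = inner_at P q (N' q) (N q)" for q
  have \<sigma>: "N' q = \<sigma> q *\<^sub>R N q" "\<sigma> q * \<sigma> q = 1" if "q \<in> S \<inter> W" for q
    using unit_normal_sign[OF S W that] unfolding \<sigma>_def .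
  have g\<sigma>: "g (cmap P k q) = \<sigma> q"
    if "q \<in> S \<inter> W" "q \<in> cdom P k" "cmap P k q \<in> U \<inter> U'" for q
    using that U(3) U'(3) inner_at_chart[OF that(2)] unfolding g_def \<sigma>_def by simp
  have const: "\<sigma> q = \<sigma> p"
    if "q \<in> S \<inter> W" "q \<in> cdom P k" "cmap P k q \<in> U \<inter> U' \<inter> U0" for q
  proof -
    have "\<bar>\<sigma> q - \<sigma> p\<bar> < 1"
      using U0(3)[of "cmap P k q"] g\<sigma>[of q] g\<sigma>[of p] that p pk U U'
      unfolding x_def[symmetric] by (simp add: dist_real_def)
    moreover have "\<sigma> q = 1 \<or> \<sigma> q = -1" "\<sigma> p = 1 \<or> \<sigma> p = -1"
      using \<sigma>(2)[OF that(1)] \<sigma>(2)[OF p] by (simp_all add: square_eq_1_iff)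
    ultimately show ?thesis by auto
  qed
  have "local_extension (S \<inter> W) p N' (\<lambda>y. \<sigma> p *\<^sub>R F y) (\<lambda>X. \<sigma> p *\<^sub>R F' X)"
    unfolding local_extension_def k_def[symmetric] x_def[symmetric]
  proof (intro conjI exI[of _ "U \<inter> U' \<inter> U0"] ballI impI has_derivative_scaleR_right[OF F])
    fix q assume q: "q \<in> S \<inter> W \<inter> cdom P k" "cmap P k q \<in> U \<inter> U' \<inter> U0"
    then have "N' q = \<sigma> p *\<^sub>R N q" using \<sigma>(1)[of q] const[of q] by simp
    then show "\<sigma> p *\<^sub>R F (cmap P k q) = coords P k q (N' q)"
      using U(3)[of q] q coords_linear[of q k] by (simp add: linear_scale)
  qed (use U U' U0 in auto)
  moreover have T: "tangent_space P (S \<inter> W) p = tangent_space P S p"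
    using tangent_space_Int[OF W(1)] p by blast
  ultimately have "cov_deriv P (S \<inter> W) N' p X = \<sigma> p *\<^sub>R cov_deriv P S N p X"
    if "X \<in> tangent_space P S p" for X
    using cov_deriv_eq[of p "S \<inter> W" X N'] cov_deriv_eq[OF _ that ext] that p \<sigma>(1)[OF p]
      bilinear_rmul[OF christoffel_bilinear[OF pk]]
    unfolding k_def[symmetric] by (simp add: scaleR_add_right)
  then show ?thesis using that[OF \<sigma>(2)[OF p]] by blast
qed

lemma mean_curvature_zero_iff:
  assumes S: "hypersurface P S" "unit_normal P S N" and W: "open W" "unit_normal P (S \<inter> W) N'"
    and p: "p \<in> S \<inter> W"
  shows "mean_curvature P (S \<inter> W) N' p = 0 \<longleftrightarrow> mean_curvature P S N p = 0"
proof -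
  have pS: "p \<in> S" using p by blast
  obtain \<sigma> where \<sigma>: "\<sigma> * \<sigma> = 1"
    "\<And>X. X \<in> tangent_space P S p \<Longrightarrow> cov_deriv P (S \<inter> W) N' p X = \<sigma> *\<^sub>R cov_deriv P S N p X"
    using cov_deriv_sign[OF S W p] by blast
  obtain F F' where "local_extension S p N F F'"
    using local_extension_exists S(2) pS unfolding unit_normal_def by blast
  then obtain A where A: "linear A" "A ` tangent_space P S p \<subseteq> tangent_space P S p"
    "\<And>X. X \<in> tangent_space P S p \<Longrightarrow> shape_operator P S N p X = A X"
    using shape_operator_linear[OF S pS] by blast
  note sub = subspace_tangent_space[OF S(1) pS]
  have "mean_curvature P (S \<inter> W) N' p = trace_on (tangent_space P S p) (\<lambda>X. \<sigma> *\<^sub>R A X)"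
    unfolding mean_curvature_def
    using tangent_space_Int[OF W(1), of p S] p \<sigma>(2) A(3)
    by (simp add: shape_operator_def trace_on_cong[OF sub, of "shape_operator P (S \<inter> W) N' p" "\<lambda>X. \<sigma> *\<^sub>R A X"]
        flip: A(3))
  also have "\<dots> = \<sigma> * trace_on (tangent_space P S p) A" by (rule trace_on_scaleR[OF sub A(1,2)])
  also have "trace_on (tangent_space P S p) A = mean_curvature P S N p"
    unfolding mean_curvature_def using trace_on_cong[OF sub] A(3) by metis
  finally show ?thesis using \<sigma>(1) by auto
qed

lemma minimal_hypersurface_iff:
  assumes "hypersurface P S" "unit_normal P S N"
  shows "minimal_hypersurface P S \<longleftrightarrow> (\<forall>p\<in>S. mean_curvature P S N p = 0)"
proof
  assume "minimal_hypersurface P S"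
  then show "\<forall>p\<in>S. mean_curvature P S N p = 0"
    unfolding minimal_hypersurface_def using mean_curvature_zero_iff[OF assms] by blast
next
  assume "\<forall>p\<in>S. mean_curvature P S N p = 0"
  then show "minimal_hypersurface P S"
    unfolding minimal_hypersurface_def using assms
    by (intro conjI ballI exI[where x = UNIV] exI[where x = N]) auto
qed

end

section \<open>The product with the real line\<close>

lemma product_with_line_simps [simp]:
  "cdom (product_with_line \<epsilon> M) i = cdom M i \<times> UNIV"
  "cmap (product_with_line \<epsilon> M) i p = (cmap M i (fst p), snd p)"
  "metric (product_with_line \<epsilon> M) i z w w' =
     metric M i (fst z) (fst w) (fst w') + \<epsilon> * (snd w * snd w')"
  "chart_at (product_with_line \<epsilon> M) p = chart_at M (fst p)"
  by (simp_all add: product_with_line_def chart_at_def split_beta mem_Times_iff)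

lemma inner_at_product_with_line [simp]:
  "inner_at (product_with_line \<epsilon> M) p w w' =
     inner_at M (fst p) (fst w) (fst w') + \<epsilon> * (snd w * snd w')"
  by (simp add: inner_at_def)

lemma cmap_product_image:
  "cmap (product_with_line \<epsilon> M) i ` (D \<times> UNIV) = cmap M i ` D \<times> UNIV"
  by (auto simp: image_iff)

lemma has_derivative_compose_fst:
  assumes "(f has_derivative D) (at y)"
  shows "((\<lambda>z. f (fst z)) has_derivative (\<lambda>w. D (fst w))) (at (y, t))"
  using has_derivative_compose[where f = fst and x = "(y, t)" and s = UNIV,
      OF bounded_linear_imp_has_derivative[OF bounded_linear_fst], of f D] assms by simp

lemma has_derivative_times_line:
  assumes "(f has_derivative D) (at y)"
  shows "((\<lambda>z. (f (fst z), snd z)) has_derivative (\<lambda>w. (D (fst w), snd w))) (at (y, t))"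
  by (intro has_derivative_Pair has_derivative_compose_fst[OF assms] has_derivative_snd has_derivative_ident)

text \<open>The pair is written as a sum of the images of its components under the linear embeddings
  of the two factors.\<close>

lemma smooth_on_times_line:
  fixes f :: "'a::real_normed_vector \<Rightarrow> 'b::real_normed_vector"
  assumes "open A" "smooth_on A f"
  shows "smooth_on (A \<times> (UNIV :: real set)) (\<lambda>z. (f (fst z), snd z))"
proof -
  have U: "open (A \<times> (UNIV :: real set))" using assms(1) by (simp add: open_Times)
  have "smooth_on (A \<times> (UNIV :: real set)) (\<lambda>z. f (0 + fst z))"
    by (rule smooth_on_compose_affine[OF bounded_linear_fst U _ assms(2)]) auto
  moreover have "bounded_linear (\<lambda>u::'b. (u, 0::real))"
    by (intro bounded_linear_Pair bounded_linear_ident bounded_linear_zero)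
  ultimately have "smooth_on (A \<times> (UNIV :: real set)) (\<lambda>z. (f (fst z), 0::real))"
    using smooth_on_linear_compose[OF _ U] by fastforce
  moreover have "bounded_linear (\<lambda>z::'a \<times> real. (0::'b, snd z))"
    by (intro bounded_linear_Pair bounded_linear_snd bounded_linear_zero)
  then have "smooth_on (A \<times> (UNIV :: real set)) (\<lambda>z. (0::'b, snd z))"
    using smooth_on_linear[OF _ U] by blast
  ultimately show ?thesis
    using smooth_on_add[OF U, of "\<lambda>z. (f (fst z), 0::real)" "\<lambda>z. (0, snd z)"] by simp
qed

context riemannian
begin

section \<open>Atlas, metric and connection of the product\<close>

lemma cinv_product:
  assumes "y \<in> cmap P i ` cdom P i"
  shows "cinv (product_with_line \<epsilon> P) i (y, t) = (cinv P i y, t)"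
  unfolding cinv_def[of "product_with_line \<epsilon> P"]
proof (rule inv_into_f_eq)
  show "inj_on (cmap (product_with_line \<epsilon> P) i) (cdom (product_with_line \<epsilon> P) i)"
    by (auto simp: inj_on_def cmap_eq_iff)
  show "(cinv P i y, t) \<in> cdom (product_with_line \<epsilon> P) i"
    "cmap (product_with_line \<epsilon> P) i (cinv P i y, t) = (y, t)" using assms by auto
qed

lemma change_coords_product:
  assumes "y \<in> cmap P i ` cdom P i"
  shows "change_coords (product_with_line \<epsilon> P) i j (y, t) = (change_coords P i j y, t)"
  by (simp add: change_coords_def cinv_product[OF assms])

lemma change_coords_has_derivative:
  assumes "p \<in> cdom P i \<inter> cdom P j"
  shows "(change_coords P i j has_derivative frechet_derivative (change_coords P i j) (at (cmap P i p)))
    (at (cmap P i p))"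
  using smooth_on_has_derivative[OF smooth_change_coords] assms by blast

lemma frechet_derivative_change_coords_product:
  assumes p: "p \<in> cdom P i \<inter> cdom P j"
  shows "frechet_derivative (change_coords (product_with_line \<epsilon> P) i j) (at (cmap P i p, t)) w =
    (frechet_derivative (change_coords P i j) (at (cmap P i p)) (fst w), snd w)"
proof -
  have U: "open (cmap P i ` cdom P i \<times> (UNIV :: real set))" "(cmap P i p, t) \<in> cmap P i ` cdom P i \<times> UNIV"
    using open_cmap_cdom p by (auto simp: open_Times)
  have "change_coords (product_with_line \<epsilon> P) i j z = (change_coords P i j (fst z), snd z)"
    if "z \<in> cmap P i ` cdom P i \<times> UNIV" for z
    using that change_coords_product[of "fst z" i \<epsilon> j "snd z"] by (simp add: mem_Times_iff)
  then have "(change_coords (product_with_line \<epsilon> P) i j has_derivative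
      (\<lambda>w. (frechet_derivative (change_coords P i j) (at (cmap P i p)) (fst w), snd w))) (at (cmap P i p, t))"
    using has_derivative_cong_open[OF U, of "change_coords (product_with_line \<epsilon> P) i j"]
      has_derivative_times_line[OF change_coords_has_derivative[OF p]] by simp
  from frechet_derivative_at[OF this] show ?thesis by metis
qed

lemma coords_product:
  assumes "fst p \<in> cdom P i"
  shows "coords (product_with_line \<epsilon> P) i p w = (coords P i (fst p) (fst w), snd w)"
  using frechet_derivative_change_coords_product[of "fst p" "chart_at P (fst p)" i \<epsilon> "snd p" w] assms chart_at
  by (simp add: coords_def)

lemma smooth_atlas_product: "smooth_atlas (prod_R P)"
  unfolding smooth_atlas_def
proof (intro conjI allI)
  have "\<exists>i. x \<in> cdom P i" for x using chart_at by blast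
  then show "(\<Union>i. cdom (prod_R P) i) = UNIV" by auto
  fix i
  have img: "cmap (prod_R P) i ` cdom (prod_R P) i = cmap P i ` cdom P i \<times> UNIV"
    using cmap_product_image[of 1 P i] by simp
  show "open (cdom (prod_R P) i)" using open_cdom by (simp add: open_Times)
  show "open (cmap (prod_R P) i ` cdom (prod_R P) i)"
    unfolding img using open_cmap_cdom by (simp add: open_Times)
  have hom: "continuous_on (cdom P i) (cmap P i)" "continuous_on (cmap P i ` cdom P i) (cinv P i)"
    using chart_homeomorphism unfolding homeomorphism_def by blast+
  have c1: "continuous_on (cdom P i \<times> (UNIV :: real set)) (\<lambda>z. (cmap P i (fst z), snd z))"
    by (intro continuous_intros continuous_on_compose2[OF hom(1)]) auto
  have "continuous_on (cmap P i ` cdom P i \<times> (UNIV :: real set)) (\<lambda>z. (cinv P i (fst z), snd z))"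
    by (intro continuous_intros continuous_on_compose2[OF hom(2)]) auto
  then have c2: "continuous_on (cmap P i ` cdom P i \<times> UNIV) (cinv (prod_R P) i)"
    by (rule continuous_on_eq) (auto simp: cinv_product)
  show "homeomorphism (cdom (prod_R P) i) (cmap (prod_R P) i ` cdom (prod_R P) i)
      (cmap (prod_R P) i) (cinv (prod_R P) i)"
    unfolding img
  proof (rule homeomorphismI)
    show "continuous_on (cdom (prod_R P) i) (cmap (prod_R P) i)" using c1 by simp
    show "continuous_on (cmap P i ` cdom P i \<times> UNIV) (cinv (prod_R P) i)" by (rule c2)
  qed (auto simp: cinv_product)
next
  fix i j
  have img: "cmap (prod_R P) i ` (cdom (prod_R P) i \<inter> cdom (prod_R P) j)
      = cmap P i ` (cdom P i \<inter> cdom P j) \<times> UNIV"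
    using cmap_product_image[of 1 P i "cdom P i \<inter> cdom P j"] by (simp add: Times_Int_distrib1)
  have U: "open (cmap P i ` (cdom P i \<inter> cdom P j))"
    using open_cmap[OF open_cdom, of i j] by (simp add: Int_commute)
  then have "open (cmap P i ` (cdom P i \<inter> cdom P j) \<times> (UNIV :: real set))" by (simp add: open_Times)
  then show "smooth_on (cmap (prod_R P) i ` (cdom (prod_R P) i \<inter> cdom (prod_R P) j)) (change_coords (prod_R P) i j)"
    unfolding img
  proof (rule smooth_on_cong[THEN iffD1, OF _ _ smooth_on_times_line[OF U smooth_change_coords]])
    show "(change_coords P i j (fst z), snd z) = change_coords (prod_R P) i j z"
      if "z \<in> cmap P i ` (cdom P i \<inter> cdom P j) \<times> UNIV" for z
      using change_coords_product[of "fst z" i 1 j "snd z"] that by (auto simp: mem_Times_iff)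
  qed
qed

lemma riemannian_metric_product: "riemannian_metric (prod_R P)"
  unfolding riemannian_metric_def
proof (intro conjI allI ballI impI)
  fix i and z :: "'e \<times> real" assume z: "z \<in> cmap (prod_R P) i ` cdom (prod_R P) i"
  then obtain p where p: "p \<in> cdom P i" "fst z = cmap P i p" by auto
  interpret local_metric "metric P i" "cmap P i ` cdom P i" "cmap P i p"
    by (rule local_metric[OF p(1)])
  show "bilinear (metric (prod_R P) i z)"
    unfolding bilinear_def p(2) product_with_line_simps
    using bilinear_ladd[OF Gx(1)] bilinear_radd[OF Gx(1)] bilinear_lmul[OF Gx(1)] bilinear_rmul[OF Gx(1)]
    by (auto simp: linear_iff algebra_simps)
  show "metric (prod_R P) i z u v = metric (prod_R P) i z v u" for u v
    using Gx(2) by (simp add: p(2) mult.commute)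
  show "0 < metric (prod_R P) i z u u" if "u \<noteq> 0" for u
  proof (cases "fst u = 0")
    case True
    then have "snd u \<noteq> 0" using that by (simp add: prod_eq_iff)
    then show ?thesis
      using True bilinear_lzero[OF Gx(1)] zero_less_power2[of "snd u"] by (simp add: p(2) power2_eq_square)
  next
    case False
    then show ?thesis using Gx(3)[of "fst u"] by (simp add: p(2) add_pos_nonneg)
  qed
next
  fix i and u v :: "'e \<times> real"
  let ?V = "cmap P i ` cdom P i"
  have U: "open (?V \<times> (UNIV :: real set))" using open_cmap_cdom by (simp add: open_Times)
  have "smooth_on ?V (\<lambda>x. metric P i x (fst u) (fst v))"
    using P unfolding riemannian_manifold_def riemannian_metric_def by blast
  then have "smooth_on (?V \<times> (UNIV :: real set)) (\<lambda>z. metric P i (0 + fst z) (fst u) (fst v))"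
    by (intro smooth_on_compose_affine[OF bounded_linear_fst U]) auto
  then have "smooth_on (?V \<times> (UNIV :: real set)) (\<lambda>z. metric P i (0 + fst z) (fst u) (fst v) + 1 * (snd u * snd v))"
    by (rule smooth_on_add[OF U _ smooth_on_const[of _ "1 * (snd u * snd v)"]])
  then show "smooth_on (cmap (prod_R P) i ` cdom (prod_R P) i) (\<lambda>z. metric (prod_R P) i z u v)"
    using cmap_product_image[of 1 P i "cdom P i"] by simp
next
  fix i j and p :: "'m \<times> real" and u v :: "'e \<times> real"
  assume "p \<in> cdom (prod_R P) i \<inter> cdom (prod_R P) j"
  then have p: "fst p \<in> cdom P i \<inter> cdom P j" by auto
  have "\<forall>i j. \<forall>p\<in>cdom P i \<inter> cdom P j. \<forall>u v.
        metric P i (cmap P i p) u v =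
          metric P j (cmap P j p)
            (frechet_derivative (change_coords P i j) (at (cmap P i p)) u)
            (frechet_derivative (change_coords P i j) (at (cmap P i p)) v)"
    using P unfolding riemannian_manifold_def riemannian_metric_def by blast
  then have "metric P i (cmap P i (fst p)) (fst u) (fst v) =
          metric P j (cmap P j (fst p))
            (frechet_derivative (change_coords P i j) (at (cmap P i (fst p))) (fst u))
            (frechet_derivative (change_coords P i j) (at (cmap P i (fst p))) (fst v))"
    using p by blast
  then show "metric (prod_R P) i (cmap (prod_R P) i p) u v =
     metric (prod_R P) j (cmap (prod_R P) j p)
      (frechet_derivative (change_coords (prod_R P) i j) (at (cmap (prod_R P) i p)) u)
      (frechet_derivative (change_coords (prod_R P) i j) (at (cmap (prod_R P) i p)) v)"
    using frechet_derivative_change_coords_product[OF p, of 1 "snd p"] by simp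
qed

lemma riemannian_product: "riemannian (prod_R P)"
  using smooth_atlas_product riemannian_metric_product
  by unfold_locales (simp add: riemannian_manifold_def)

text \<open>The metric coefficients do not depend on \<open>t\<close> and that of
  \<open>dt\<^sup>2\<close> is constant, so the Christoffel map of \<open>M\<close> padded with zero
  satisfies the Levi-Civita conditions; uniqueness does the rest.\<close>

lemma christoffel_product:
  assumes p: "p \<in> cdom P i"
  shows "christoffel (prod_R P) i (cmap P i p, t) w w' = (christoffel P i (cmap P i p) (fst w) (fst w'), 0)"
proof -
  interpret prod: riemannian "prod_R P" by (rule riemannian_product)
  interpret G: local_metric "metric P i" "cmap P i ` cdom P i" "cmap P i p"
    by (rule local_metric[OF p])
  have pt: "(p, t) \<in> cdom (prod_R P) i" using p by simp
  interpret G': local_metric "metric (prod_R P) i" "cmap (prod_R P) i ` cdom (prod_R P) i" "(cmap P i p, t)"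
    using prod.local_metric[OF pt] by simp
  let ?\<Gamma> = "christoffel P i (cmap P i p)"
  have lc: "G.levi_civita ?\<Gamma>" by (rule christoffel[OF p])
  have "G'.levi_civita (\<lambda>w w'. (?\<Gamma> (fst w) (fst w'), 0))"
    unfolding G'.levi_civita_def
  proof (intro conjI allI)
    show "(?\<Gamma> (fst u) (fst v), 0) = (?\<Gamma> (fst v) (fst u), 0::real)" for u v :: "'e \<times> real"
      using lc unfolding G.levi_civita_def by simp
    fix u v w :: "'e \<times> real"
    have "((\<lambda>z. metric P i (fst z) (fst v) (fst w)) has_derivative (\<lambda>u. G.dG (fst u) (fst v) (fst w)))
        (at (cmap P i p, t))"
      by (rule has_derivative_compose_fst[OF G.dG])
    then have "((\<lambda>z. metric (prod_R P) i z v w) has_derivative (\<lambda>u. G.dG (fst u) (fst v) (fst w)))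
        (at (cmap P i p, t))"
      by (auto intro!: derivative_eq_intros)
    then have "frechet_derivative (\<lambda>z. metric (prod_R P) i z v w) (at (cmap P i p, t)) u
        = G.dG (fst u) (fst v) (fst w)"
      using frechet_derivative_at by metis
    also have "\<dots> = metric P i (cmap P i p) (?\<Gamma> (fst u) (fst v)) (fst w)
        + metric P i (cmap P i p) (fst v) (?\<Gamma> (fst u) (fst w))"
      using lc unfolding G.levi_civita_def G.dG_def by blast
    finally show "frechet_derivative (\<lambda>z. metric (prod_R P) i z v w) (at (cmap P i p, t)) u =
        metric (prod_R P) i (cmap P i p, t) (?\<Gamma> (fst u) (fst v), 0) w
        + metric (prod_R P) i (cmap P i p, t) v (?\<Gamma> (fst u) (fst w), 0)" by simp
  qed
  moreover have "G'.levi_civita (christoffel (prod_R P) i (cmap P i p, t))"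
    using prod.christoffel[OF pt] by simp
  ultimately show ?thesis using G'.levi_civita_unique by metis
qed

end

section \<open>Hypersurfaces without horizontal points\<close>

lemma powr_minus_half_square: "0 < (a::real) \<Longrightarrow> a powr (-1/2) * (a powr (-1/2) * a) = 1"
  using powr_add[of a "-1/2" "-1/2"] by (simp add: powr_minus_divide)

locale no_horizontal_points = riemannian M
  for M :: "('i, 'm::{t2_space,second_countable_topology}, 'e::euclidean_space) manifold_data" +
  fixes \<Sigma> :: "('m \<times> real) set" and N :: "'m \<times> real \<Rightarrow> 'e \<times> real"
  assumes hyp: "hypersurface (prod_R M) \<Sigma>"
    and nrm: "unit_normal (prod_R M) \<Sigma> N"
    and no_horizontal: "\<And>p. p \<in> \<Sigma> \<Longrightarrow> \<not> horizontal_point M \<Sigma> p"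
begin

interpretation prod: riemannian "prod_R M" by (rule riemannian_product)

section \<open>The angle and the gradient of the height\<close>

abbreviation "\<nu> p \<equiv> fst (N p)"
abbreviation "\<theta> p \<equiv> snd (N p)"

text \<open>The components of \<open>vertical - \<theta> p *\<^sub>R N p\<close>, the tangential
  part of the vertical field.\<close>

definition height_gradient :: "'m \<times> real \<Rightarrow> 'e \<times> real" where
  "height_gradient p = (- \<theta> p *\<^sub>R \<nu> p, 1 - (\<theta> p)\<^sup>2)"

lemma angle_eq [simp]: "angle M N p = \<theta> p"
  by (simp add: angle_def vertical_def inner_at_simps)

lemma inner_horizontal: "p \<in> \<Sigma> \<Longrightarrow> inner_at M (fst p) (\<nu> p) (\<nu> p) = 1 - (\<theta> p)\<^sup>2"
  using nrm unfolding unit_normal_def by (auto simp: power2_eq_square algebra_simps)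

lemma tangent_eq:
  "p \<in> \<Sigma> \<Longrightarrow>
    tangent_space (prod_R M) \<Sigma> p = {w. inner_at M (fst p) (\<nu> p) (fst w) + \<theta> p * snd w = 0}"
  using prod.tangent_space_normal[OF hyp nrm] by simp

lemma deriv_along_height:
  assumes "p \<in> \<Sigma>" "X \<in> tangent_space (prod_R M) \<Sigma> p"
  shows "deriv_along (prod_R M) \<Sigma> height p X = snd X"
  by (rule prod.deriv_along_eq[where F = snd and F' = snd, OF assms open_UNIV UNIV_I _
        bounded_linear_imp_has_derivative[OF bounded_linear_snd]]) simp

text \<open>Otherwise the horizontal part of \<open>N\<close> would have nonpositive square and
  vanish. All tangent vectors would then be horizontal, and \<open>p\<close> would be a critical
  point of the height.\<close>

lemma angle_less_1:
  assumes p: "p \<in> \<Sigma>"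
  shows "(\<theta> p)\<^sup>2 < 1"
proof (rule ccontr)
  assume "\<not> (\<theta> p)\<^sup>2 < 1"
  then have "inner_at M (fst p) (\<nu> p) (\<nu> p) \<le> 0" using inner_horizontal[OF p] by simp
  then have \<nu>: "\<nu> p = 0" using inner_at_pos[of "\<nu> p" "fst p"] by fastforce
  then have "(\<theta> p)\<^sup>2 = 1" using inner_horizontal[OF p] by (simp add: inner_at_simps)
  then have "\<theta> p \<noteq> 0" by auto
  then have "snd X = 0" if "X \<in> tangent_space (prod_R M) \<Sigma> p" for X
    using that \<nu> unfolding tangent_eq[OF p] by (simp add: inner_at_simps)
  then have "horizontal_point M \<Sigma> p"
    unfolding horizontal_point_def using deriv_along_height[OF p] p by simp
  then show False using no_horizontal[OF p] by blast
qed

lemma height_gradient_tangent: "p \<in> \<Sigma> \<Longrightarrow> height_gradient p \<in> tangent_space (prod_R M) \<Sigma> p"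
  by (simp add: tangent_eq height_gradient_def inner_at_simps inner_horizontal algebra_simps)

lemma inner_height_gradient:
  assumes p: "p \<in> \<Sigma>" and X: "X \<in> tangent_space (prod_R M) \<Sigma> p"
  shows "inner_at (prod_R M) p X (height_gradient p) = snd X"
proof -
  have "inner_at M (fst p) (\<nu> p) (fst X) = - \<theta> p * snd X" using X unfolding tangent_eq[OF p] by simp
  then show ?thesis
    using inner_at_sym[of "fst p" "fst X" "\<nu> p"]
    by (simp add: height_gradient_def inner_at_simps power2_eq_square algebra_simps)
qed

lemma gradient_on_height:
  assumes p: "p \<in> \<Sigma>"
  shows "gradient_on (prod_R M) \<Sigma> height p = height_gradient p"
  unfolding gradient_on_def
proof (rule the_equality, intro conjI ballI)
  let ?T = "tangent_space (prod_R M) \<Sigma> p"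
  show "height_gradient p \<in> ?T" by (rule height_gradient_tangent[OF p])
  have grad: "inner_at (prod_R M) p (height_gradient p) X = deriv_along (prod_R M) \<Sigma> height p X"
    if "X \<in> ?T" for X
    using inner_height_gradient[OF p that] prod.inner_at_sym[of p X "height_gradient p"]
      deriv_along_height[OF p that] by simp
  then show "inner_at (prod_R M) p (height_gradient p) X = deriv_along (prod_R M) \<Sigma> height p X"
    if "X \<in> ?T" for X using that .
  fix v assume v: "v \<in> ?T \<and> (\<forall>X\<in>?T. inner_at (prod_R M) p v X = deriv_along (prod_R M) \<Sigma> height p X)"
  define d where "d = v - height_gradient p"
  have "d \<in> ?T"
    unfolding d_def using v height_gradient_tangent[OF p] prod.subspace_tangent_space[OF hyp p]
    by (simp add: subspace_diff)
  moreover have "inner_at (prod_R M) p d d = inner_at (prod_R M) p v d - inner_at (prod_R M) p (height_gradient p) d"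
    using bilinear_lsub[OF prod.inner_at_bilinear, of p v "height_gradient p" d] by (simp only: d_def)
  ultimately have "inner_at (prod_R M) p d d = 0"
    using v grad[of d] by (simp del: inner_at_product_with_line)
  then show "v = height_gradient p" using prod.inner_at_eq_0[of p d] by (simp add: d_def)
qed

section \<open>Horizontal sections and their unit normals\<close>

lemma mem_section_at: "x \<in> section_at \<Sigma> t \<longleftrightarrow> (x, t) \<in> \<Sigma>"
  by (force simp: section_at_def)

text \<open>Makes the condition in \<open>minimal_sections\<close> hold for every \<open>t\<close>,
  so that all points of \<Sigma> are reached by sections.\<close>

lemma transversal: "transversal_at_height M \<Sigma> t"
  unfolding transversal_at_height_def
proof (intro ballI)
  fix p assume "p \<in> \<Sigma> \<inter> (UNIV \<times> {t})"
  then have p: "p \<in> \<Sigma>" "snd p = t" by auto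
  define k where "k = chart_at M (fst p)"
  have pk: "fst p \<in> cdom M k" unfolding k_def by (rule chart_at)
  have hor: "Y \<in> tangent_space (prod_R M) (UNIV \<times> {t}) p" if "snd Y = 0" for Y
  proof -
    let ?c = "\<lambda>s::real. (cmap M k (fst p) + s *\<^sub>R fst Y, t)"
    have "((\<lambda>s. cmap M k (fst p) + s *\<^sub>R fst Y) \<longlongrightarrow> cmap M k (fst p) + 0 *\<^sub>R fst Y) (at 0)"
      by (intro tendsto_intros)
    then have "\<forall>\<^sub>F s in at 0. cmap M k (fst p) + s *\<^sub>R fst Y \<in> cmap M k ` cdom M k"
      using topological_tendstoD[OF _ open_cmap_cdom] pk by fastforce
    moreover have "(cmap M k x, t) \<in> cmap (prod_R M) k ` ((UNIV \<times> {t}) \<inter> cdom (prod_R M) k)"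
      if "x \<in> cdom M k" for x
      by (rule image_eqI[of _ _ "(x, t)"]) (use that in auto)
    ultimately have "\<forall>\<^sub>F s in at 0. ?c s \<in> cmap (prod_R M) k ` ((UNIV \<times> {t}) \<inter> cdom (prod_R M) k)"
      by (auto elim!: eventually_mono)
    moreover have "(?c has_vector_derivative Y) (at 0)"
      using that by (auto intro!: derivative_eq_intros simp: prod_eq_iff has_vector_derivative_def)
    ultimately have "Y \<in> velocities (cmap (prod_R M) k p)
        (cmap (prod_R M) k ` ((UNIV \<times> {t}) \<inter> cdom (prod_R M) k))"
      unfolding velocities_def using p(2) by (intro CollectI exI[of _ ?c]) auto
    then show ?thesis unfolding prod.tangent_space_velocities by (simp add: k_def)
  qed
  have "\<exists>X Y. w = X + Y \<and> X \<in> tangent_space (prod_R M) \<Sigma> p \<and>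
      Y \<in> tangent_space (prod_R M) (UNIV \<times> {t}) p" for w
  proof -
    \<comment> \<open>The multiple of the height gradient with the same vertical component as
      \<open>w\<close>; the remainder is horizontal.\<close>
    define X where "X = (snd w / (1 - (\<theta> p)\<^sup>2)) *\<^sub>R height_gradient p"
    have "X \<in> tangent_space (prod_R M) \<Sigma> p"
      unfolding X_def using height_gradient_tangent[OF p(1)] prod.subspace_tangent_space[OF hyp p(1)]
      by (rule subspace_scale[rotated])
    moreover have "w - X \<in> tangent_space (prod_R M) (UNIV \<times> {t}) p"
      by (rule hor) (use angle_less_1[OF p(1)] in \<open>simp add: X_def height_gradient_def\<close>)
    ultimately show ?thesis by (metis add_diff_cancel_left' diff_add_cancel add.commute)
  qed
  then show "{X + Y |X Y. X \<in> tangent_space (prod_R M) \<Sigma> p \<and>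
      Y \<in> tangent_space (prod_R M) (UNIV \<times> {t}) p} = UNIV" by blast
qed

text \<open>A curve in the section, lifted to height \<open>t\<close>, runs in \<Sigma>. This
  inclusion suffices to check orthogonality of the section normal, and the full tangent space then
  follows from \<open>tangent_space_normal\<close>.\<close>

lemma tangent_section:
  assumes "X \<in> tangent_space M (section_at \<Sigma> t) x"
  shows "(X, 0) \<in> tangent_space (prod_R M) \<Sigma> (x, t)"
proof -
  define k where "k = chart_at M x"
  obtain c where c: "c 0 = cmap M k x" "\<forall>\<^sub>F s in at (0::real). c s \<in> cmap M k ` (section_at \<Sigma> t \<inter> cdom M k)"
    "(c has_vector_derivative X) (at 0)"
    using assms unfolding tangent_space_velocities velocities_def k_def by blast
  have "\<forall>\<^sub>F s in at 0. (c s, t) \<in> cmap (prod_R M) k ` (\<Sigma> \<inter> cdom (prod_R M) k)"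
    using c(2) by eventually_elim (auto simp: mem_section_at image_iff intro!: bexI)
  moreover have "((\<lambda>s. (c s, t)) has_vector_derivative (X, 0)) (at 0)"
    using c(3) by (intro has_vector_derivative_Pair has_vector_derivative_const)
  ultimately have "(X, 0) \<in> velocities (cmap (prod_R M) k (x, t))
      (cmap (prod_R M) k ` (\<Sigma> \<inter> cdom (prod_R M) k))"
    unfolding velocities_def using c(1) by (intro CollectI exI[of _ "\<lambda>s. (c s, t)"]) simp
  then show ?thesis unfolding prod.tangent_space_velocities by (simp add: k_def)
qed

text \<open>Restrict a defining function \<open>h\<close> to the slice. If the restricted
  differential vanished, the differential of \<open>h\<close> would be a multiple of
  \<open>dt\<close>; it kills the height gradient, whose vertical component is nonzero, so it would
  be zero.\<close>

lemma hypersurface_section: "hypersurface M (section_at \<Sigma> t)"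
  unfolding hypersurface_def
proof
  fix x assume "x \<in> section_at \<Sigma> t"
  then have "(x, t) \<in> \<Sigma>" by (simp add: mem_section_at)
  then obtain W h where W: "open W" "(x, t) \<in> W" and h: "smooth_function_on (prod_R M) W h"
    and SW: "\<Sigma> \<inter> W = {q \<in> W. h q = 0}"
    and d: "\<forall>q\<in>\<Sigma> \<inter> W. \<exists>v. differential (prod_R M) h q v \<noteq> 0"
    using hyp unfolding hypersurface_def by blast
  define W' where "W' = (\<lambda>y. (y, t)) -` W"
  define h' where "h' y = h (y, t)" for y
  have W': "open W'" "x \<in> W'"
    using W unfolding W'_def by (auto intro!: open_vimage continuous_intros)
  have inc: "bounded_linear (\<lambda>u::'e. (u, 0::real))"
    by (intro bounded_linear_Pair bounded_linear_ident bounded_linear_zero)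
  have h'_eq: "(h \<circ> cinv (prod_R M) i) ((0, t) + (y, 0)) = (h' \<circ> cinv M i) y"
    if "y \<in> cmap M i ` (W' \<inter> cdom M i)" for i y
    using that cinv_product[of y i 1 t] by (auto simp: h'_def)
  have smooth: "smooth_function_on M W' h'"
    unfolding smooth_function_on_def
  proof
    fix i
    have U: "open (cmap M i ` (W' \<inter> cdom M i))" by (rule open_cmap[OF W'(1)])
    have "smooth_on (cmap M i ` (W' \<inter> cdom M i)) (\<lambda>y. (h \<circ> cinv (prod_R M) i) ((0, t) + (y, 0)))"
    proof (rule smooth_on_compose_affine[OF inc U])
      show "smooth_on (cmap (prod_R M) i ` (W \<inter> cdom (prod_R M) i)) (h \<circ> cinv (prod_R M) i)"
        using h unfolding smooth_function_on_def by blast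
      show "(\<lambda>u. (0, t) + (u, 0)) ` cmap M i ` (W' \<inter> cdom M i) \<subseteq> cmap (prod_R M) i ` (W \<inter> cdom (prod_R M) i)"
        by (force simp: W'_def image_iff)
    qed
    then show "smooth_on (cmap M i ` (W' \<inter> cdom M i)) (h' \<circ> cinv M i)"
      using smooth_on_cong[OF U, of "\<lambda>y. (h \<circ> cinv (prod_R M) i) ((0, t) + (y, 0))" "h' \<circ> cinv M i"]
        h'_eq[of _ i] by blast
  qed
  have nonzero: "\<exists>v. differential M h' y v \<noteq> 0" if y: "y \<in> section_at \<Sigma> t \<inter> W'" for y
  proof (rule ccontr)
    assume "\<nexists>v. differential M h' y v \<noteq> 0"
    then have zero: "differential M h' y v = 0" for v by blast
    define k where "k = chart_at M y"
    define \<phi> where "\<phi> = differential (prod_R M) h (y, t)"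
    have yk: "y \<in> cdom M k" unfolding k_def by (rule chart_at)
    have yW: "(y, t) \<in> \<Sigma> \<inter> W" using y by (simp add: mem_section_at W'_def)
    then obtain w where w: "\<phi> w \<noteq> 0" using d unfolding \<phi>_def by blast
    have lin: "linear \<phi>" and T: "tangent_space (prod_R M) \<Sigma> (y, t) = {v. \<phi> v = 0}"
      using prod.tangent_space_level_set[OF W(1) h SW yW] w unfolding \<phi>_def by blast+
    have U: "open (cmap M k ` (W' \<inter> cdom M k))" "cmap M k y \<in> cmap M k ` (W' \<inter> cdom M k)"
      using open_cmap[OF W'(1)] y yk by auto
    have "smooth_on (cmap (prod_R M) k ` (W \<inter> cdom (prod_R M) k)) (h \<circ> cinv (prod_R M) k)"
      using h unfolding smooth_function_on_def by blast
    moreover have "(cmap M k y, t) \<in> cmap (prod_R M) k ` (W \<inter> cdom (prod_R M) k)"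
      using yW yk by (force simp: image_iff)
    ultimately have "((h \<circ> cinv (prod_R M) k) has_derivative \<phi>) (at (cmap M k y, t))"
      using smooth_on_has_derivative unfolding \<phi>_def differential_def by (fastforce simp: k_def)
    then have "((h \<circ> cinv (prod_R M) k) has_derivative \<phi>) (at ((0, t) + (cmap M k y, 0)))" by simp
    moreover have "((\<lambda>u. (0, t) + (u, 0)) has_derivative (\<lambda>u. (u, 0::real))) (at (cmap M k y))"
      using bounded_linear_imp_has_derivative[OF inc] by (auto intro!: derivative_eq_intros)
    ultimately have "((\<lambda>u. (h \<circ> cinv (prod_R M) k) ((0, t) + (u, 0))) has_derivative (\<lambda>u. \<phi> (u, 0)))
        (at (cmap M k y))"
      using has_derivative_compose by fastforce
    then have "((h' \<circ> cinv M k) has_derivative (\<lambda>u. \<phi> (u, 0))) (at (cmap M k y))"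
      using has_derivative_cong_open[OF U, of "\<lambda>y. (h \<circ> cinv (prod_R M) k) ((0, t) + (y, 0))" "h' \<circ> cinv M k"]
        h'_eq[of _ k] by blast
    then have "differential M h' y = (\<lambda>u. \<phi> (u, 0))"
      unfolding differential_def k_def[symmetric] by (metis frechet_derivative_at)
    then have hor: "\<phi> (u, 0) = 0" for u using zero by metis
    have split: "\<phi> v = snd v * \<phi> (0, 1)" for v
    proof -
      have "\<phi> v = \<phi> ((fst v, 0) + snd v *\<^sub>R (0, 1))" by simp
      also have "\<dots> = snd v * \<phi> (0, 1)" unfolding linear_add[OF lin] linear_scale[OF lin] hor by simp
      finally show ?thesis .
    qed
    have "\<phi> (height_gradient (y, t)) = 0" using height_gradient_tangent yW T by blast
    moreover have "snd (height_gradient (y, t)) \<noteq> 0"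
      using angle_less_1[of "(y, t)"] yW by (simp add: height_gradient_def)
    ultimately have "\<phi> (0, 1) = 0" using split[of "height_gradient (y, t)"] by simp
    then show False using split[of w] w by simp
  qed
  have "section_at \<Sigma> t \<inter> W' = {q \<in> W'. h' q = 0}"
  proof (rule set_eqI)
    fix y
    have "(y, t) \<in> \<Sigma> \<inter> W \<longleftrightarrow> (y, t) \<in> {q \<in> W. h q = 0}" unfolding SW ..
    then show "y \<in> section_at \<Sigma> t \<inter> W' \<longleftrightarrow> y \<in> {q \<in> W'. h' q = 0}"
      by (simp add: mem_section_at W'_def h'_def)
  qed
  then show "\<exists>W h. open W \<and> x \<in> W \<and> smooth_function_on M W h \<and>
        section_at \<Sigma> t \<inter> W = {q \<in> W. h q = 0} \<and> (\<forall>q\<in>section_at \<Sigma> t \<inter> W. \<exists>v. differential M h q v \<noteq> 0)"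
    using W' smooth nonzero by blast
qed

text \<open>Written with \<open>powr\<close> so that smoothness comes from
  \<open>smooth_on_powr\<close>.\<close>

definition section_normal :: "real \<Rightarrow> 'm \<Rightarrow> 'e" where
  "section_normal t x = (1 - (\<theta> (x, t))\<^sup>2) powr (-1/2) *\<^sub>R \<nu> (x, t)"

lemma unit_normal_section: "unit_normal M (section_at \<Sigma> t) (section_normal t)"
  unfolding unit_normal_def
proof (intro conjI ballI)
  fix x assume "x \<in> section_at \<Sigma> t"
  then have p: "(x, t) \<in> \<Sigma>" by (simp add: mem_section_at)
  show "inner_at M x (section_normal t x) (section_normal t x) = 1"
    using inner_horizontal[OF p] angle_less_1[OF p] powr_minus_half_square[of "1 - (\<theta> (x, t))\<^sup>2"]
    by (simp add: section_normal_def inner_at_simps)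
  show "inner_at M x (section_normal t x) X = 0" if "X \<in> tangent_space M (section_at \<Sigma> t) x" for X
    using tangent_section[OF that] by (simp add: tangent_eq[OF p] section_normal_def inner_at_simps)
next
  show "smooth_field_along M (section_at \<Sigma> t) (section_normal t)"
    unfolding smooth_field_along_def
  proof (intro ballI allI impI)
    fix x i assume x: "x \<in> section_at \<Sigma> t" "x \<in> cdom M i"
    have p: "(x, t) \<in> \<Sigma>" using x(1) by (simp add: mem_section_at)
    obtain U F where U: "open U" "(cmap M i x, t) \<in> U" and F: "smooth_on U F"
      "\<And>q. q \<in> \<Sigma> \<Longrightarrow> q \<in> cdom (prod_R M) i \<Longrightarrow> cmap (prod_R M) i q \<in> U \<Longrightarrow>
         F (cmap (prod_R M) i q) = coords (prod_R M) i q (N q)"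
    proof -
      have "(x, t) \<in> cdom (prod_R M) i" using x by simp
      then have "\<exists>U F. open U \<and> cmap (prod_R M) i (x, t) \<in> U \<and> smooth_on U F \<and>
          (\<forall>q\<in>\<Sigma> \<inter> cdom (prod_R M) i. cmap (prod_R M) i q \<in> U \<longrightarrow>
             F (cmap (prod_R M) i q) = coords (prod_R M) i q (N q))"
        using nrm p unfolding unit_normal_def smooth_field_along_def by blast
      then show ?thesis using that by auto
    qed
    have F_eq: "F (cmap M i q, t) = (coords M i q (\<nu> (q, t)), \<theta> (q, t))"
      if "(q, t) \<in> \<Sigma>" "q \<in> cdom M i" "(cmap M i q, t) \<in> U" for q
      using F(2)[of "(q, t)"] that coords_product[of "(q, t)" i 1] by simp
    define V where "V = (\<lambda>y. (y, t)) -` U"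
    have V: "open V" unfolding V_def using U(1) by (auto intro!: open_vimage continuous_intros)
    have inc: "bounded_linear (\<lambda>u::'e. (u, 0::real))"
      by (intro bounded_linear_Pair bounded_linear_ident bounded_linear_zero)
    have "smooth_on V (\<lambda>y. F ((0, t) + (y, 0)))"
      by (rule smooth_on_compose_affine[OF inc V _ F(1)]) (auto simp: V_def)
    then have FV: "smooth_on V (\<lambda>y. F (y, t))" by simp
    define f where "f y = 1 + (-1) *\<^sub>R (snd (F (y, t)) *\<^sub>R snd (F (y, t)))" for y
    have f: "smooth_on V f"
      unfolding f_def
      by (intro smooth_on_add[OF V] smooth_on_scaleR[OF V] smooth_on_const
          smooth_on_linear_compose[OF bounded_linear_snd V FV])
    \<comment> \<open>Off \<Sigma> the extension \<open>F\<close> of \<open>N\<close> need not be a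
      unit vector, so positivity of \<open>f\<close> has to be secured by shrinking before the power
      is taken.\<close>
    define V' where "V' = V \<inter> f -` {0<..}"
    have V': "open V'"
      unfolding V'_def by (rule continuous_open_preimage[OF smooth_on_continuous_on[OF f] V open_greaterThan])
    have sub: "V' \<subseteq> V" by (auto simp: V'_def)
    have "smooth_on V' (\<lambda>y. f y powr (-1/2) *\<^sub>R fst (F (y, t)))"
      by (intro smooth_on_scaleR[OF V'] smooth_on_powr[OF V'] smooth_on_subset[OF f sub]
          smooth_on_linear_compose[OF bounded_linear_fst V'] smooth_on_subset[OF FV sub])
        (auto simp: V'_def)
    moreover have "f (cmap M i q) powr (-1/2) *\<^sub>R fst (F (cmap M i q, t)) = coords M i q (section_normal t q)"
      if "q \<in> section_at \<Sigma> t \<inter> cdom M i" "cmap M i q \<in> V'" for q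
      using that F_eq[of q] linear_scale[OF coords_linear[of q i]] sub
      by (auto simp: f_def section_normal_def mem_section_at V_def power2_eq_square)
    moreover have "cmap M i x \<in> V'"
      using F_eq[of x] p x(2) U(2) angle_less_1[OF p] by (simp add: V'_def V_def f_def power2_eq_square)
    ultimately show "\<exists>U F. open U \<and> cmap M i x \<in> U \<and> smooth_on U F \<and>
        (\<forall>q\<in>section_at \<Sigma> t \<inter> cdom M i. cmap M i q \<in> U \<longrightarrow> F (cmap M i q) = coords M i q (section_normal t q))"
      using V' by blast
  qed
qed

lemma tangent_section_eq:
  assumes "(x, t) \<in> \<Sigma>"
  shows "tangent_space M (section_at \<Sigma> t) x = {u. inner_at M x (\<nu> (x, t)) u = 0}"
  using tangent_space_normal[OF hypersurface_section unit_normal_section, of x t] assms angle_less_1[OF assms]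
  by (simp add: mem_section_at section_normal_def inner_at_simps)

subsection \<open>Comparison of the curvatures\<close>

lemma local_extension_prod:
  assumes "p \<in> \<Sigma>"
  obtains F F' where "prod.local_extension \<Sigma> p N F F'"
  using prod.local_extension_exists[of \<Sigma> N p] nrm assms unfolding unit_normal_def by metis

text \<open>Differentiating the scalar normalising factor only adds a multiple of the horizontal
  part of \<open>N\<close>. That vector is normal to the section, so the coefficient
  \<open>m\<close> can stay unspecified and is later eliminated by orthogonality.\<close>

lemma local_extension_section:
  assumes p: "(x, t) \<in> \<Sigma>" and F: "prod.local_extension \<Sigma> (x, t) N F F'"
  obtains H m where "local_extension (section_at \<Sigma> t) x (section_normal t) H
    (\<lambda>u. (1 - (\<theta> (x, t))\<^sup>2) powr (-1/2) *\<^sub>R fst (F' (u, 0)) + m u *\<^sub>R \<nu> (x, t))"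
proof -
  define k where "k = chart_at M x"
  define y0 where "y0 = cmap M k x"
  obtain U where U: "open U" "(y0, t) \<in> U"
    and ext: "\<And>q. q \<in> \<Sigma> \<Longrightarrow> q \<in> cdom (prod_R M) k \<Longrightarrow> cmap (prod_R M) k q \<in> U \<Longrightarrow>
       F (cmap (prod_R M) k q) = coords (prod_R M) k q (N q)"
    and F': "(F has_derivative F') (at (y0, t))"
    using F unfolding prod.local_extension_def by (auto simp: k_def y0_def)
  have Fx: "F (y0, t) = N (x, t)"
    using prod.local_extension_at[OF F p] by (simp add: k_def y0_def)
  define \<rho> where "\<rho> r = (1 - r\<^sup>2) powr (-1/2)" for r :: real
  have "((\<lambda>r. 1 - r\<^sup>2) has_real_derivative (- 2 * \<theta> (x, t))) (at (\<theta> (x, t)))"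
    by (auto intro!: derivative_eq_intros)
  from DERIV_chain2[OF has_real_derivative_powr this]
  obtain c where "(\<rho> has_real_derivative c) (at (\<theta> (x, t)))"
    using angle_less_1[OF p] unfolding \<rho>_def by (auto simp: field_simps)
  then have \<rho>': "(\<rho> has_derivative (\<lambda>s. c * s)) (at (snd (F (y0, t))))"
    by (simp add: Fx has_field_derivative_def)
  have inc: "((\<lambda>y. (y, t)) has_derivative (\<lambda>u. (u, 0))) (at y0)"
    by (intro has_derivative_Pair has_derivative_ident has_derivative_const)
  have Ft: "((\<lambda>y. F (y, t)) has_derivative (\<lambda>u. F' (u, 0))) (at y0)"
    using has_derivative_compose[OF inc F'] .
  have "((\<lambda>y. \<rho> (snd (F (y, t)))) has_derivative (\<lambda>u. c * snd (F' (u, 0)))) (at y0)"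
    using has_derivative_compose[OF has_derivative_snd[OF Ft] \<rho>'] .
  from has_derivative_scaleR[OF this has_derivative_fst[OF Ft]]
  have H': "((\<lambda>y. \<rho> (snd (F (y, t))) *\<^sub>R fst (F (y, t))) has_derivative
      (\<lambda>u. (1 - (\<theta> (x, t))\<^sup>2) powr (-1/2) *\<^sub>R fst (F' (u, 0)) + (c * snd (F' (u, 0))) *\<^sub>R \<nu> (x, t))) (at y0)"
    by (simp add: Fx \<rho>_def)
  define V where "V = (\<lambda>y. (y, t)) -` U"
  have V: "open V" "y0 \<in> V"
    unfolding V_def using U by (auto intro!: open_vimage continuous_intros)
  have "\<rho> (snd (F (cmap M k q, t))) *\<^sub>R fst (F (cmap M k q, t)) = coords M k q (section_normal t q)"
    if "q \<in> section_at \<Sigma> t \<inter> cdom M k" "cmap M k q \<in> V" for q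
  proof -
    have "F (cmap M k q, t) = (coords M k q (\<nu> (q, t)), \<theta> (q, t))"
      using ext[of "(q, t)"] that coords_product[of "(q, t)" k 1] by (simp add: mem_section_at V_def)
    then show ?thesis
      using linear_scale[OF coords_linear[of q k]] that by (simp add: \<rho>_def section_normal_def)
  qed
  then have "local_extension (section_at \<Sigma> t) x (section_normal t)
      (\<lambda>y. \<rho> (snd (F (y, t))) *\<^sub>R fst (F (y, t)))
      (\<lambda>u. (1 - (\<theta> (x, t))\<^sup>2) powr (-1/2) *\<^sub>R fst (F' (u, 0)) + (c * snd (F' (u, 0))) *\<^sub>R \<nu> (x, t))"
    unfolding local_extension_def k_def[symmetric] y0_def[symmetric] using V H' by blast
  then show ?thesis by (rule that)
qed

text \<open>The shape operator of the section is the compression of \<open>A\<close> along \<open>\<nabla>\<xi>\<close>, divided by the length of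
  the horizontal part of \<open>N\<close>.\<close>

lemma mean_curvature_section:
  assumes p: "p \<in> \<Sigma>"
  shows "mean_curvature (prod_R M) \<Sigma> N p =
    sqrt (1 - (\<theta> p)\<^sup>2) * mean_curvature M (section_at \<Sigma> (snd p)) (section_normal (snd p)) (fst p)
    + inner_at (prod_R M) p (shape_operator (prod_R M) \<Sigma> N p (height_gradient p)) (height_gradient p)
      / (1 - (\<theta> p)\<^sup>2)"
proof -
  obtain x t where xt: "p = (x, t)" by fastforce
  define R where "R = 1 - (\<theta> p)\<^sup>2"
  have R: "R > 0" using angle_less_1[OF p] by (simp add: R_def)
  define T where "T = tangent_space (prod_R M) \<Sigma> p"
  define T0 where "T0 = tangent_space M (section_at \<Sigma> t) x"
  have T: "T = {w. inner_at M x (\<nu> p) (fst w) + \<theta> p * snd w = 0}"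
    unfolding T_def tangent_eq[OF p] by (simp add: xt)
  have T0: "T0 = {u. inner_at M x (\<nu> p) u = 0}"
    unfolding T0_def xt using tangent_section_eq p by (simp add: xt)
  have \<nu>\<nu>: "inner_at M x (\<nu> p) (\<nu> p) = R" using inner_horizontal[OF p] by (simp add: R_def xt)
  obtain F F' where F: "prod.local_extension \<Sigma> p N F F'" by (rule local_extension_prod[OF p])
  define A where "A X = - (F' X + christoffel (prod_R M) (chart_at (prod_R M) p)
      (cmap (prod_R M) (chart_at (prod_R M) p) p) X (N p))" for X
  have A: "linear A" "A ` T \<subseteq> T" "\<And>X. X \<in> T \<Longrightarrow> shape_operator (prod_R M) \<Sigma> N p X = A X"
    unfolding A_def T_def using prod.shape_operator_linear[OF hyp nrm p F] by blast+
  have A_eq: "A X = - (F' X + (christoffel M (chart_at M x) (cmap M (chart_at M x) x) (fst X) (\<nu> p), 0))" for X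
    using christoffel_product[OF chart_at, of x t X "N p"] by (simp add: A_def xt)
  have xsec: "x \<in> section_at \<Sigma> t" using p by (simp add: mem_section_at xt)
  define r where "r = R powr (-1/2)"
  have r: "r * sqrt R = 1" "r > 0"
    using R by (simp_all add: r_def powr_minus_divide powr_half_sqrt)
  obtain H m where H: "local_extension (section_at \<Sigma> t) x (section_normal t) H
      (\<lambda>u. r *\<^sub>R fst (F' (u, 0)) + m u *\<^sub>R \<nu> p)"
    using local_extension_section[of x t F F'] p F unfolding r_def R_def xt by blast
  \<comment> \<open>The projection onto the horizontal vectors along the height gradient:
    \<open>q w\<close> is the first component of
    \<open>w - (snd w / R) *\<^sub>R height_gradient p\<close>.\<close>
  define q where "q w = fst w + (\<theta> p * snd w / R) *\<^sub>R \<nu> p" for w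
  have q_T0: "q w \<in> T0" if "w \<in> T" for w
    using that R unfolding T T0 by (simp add: q_def inner_at_simps \<nu>\<nu>)
  have shape: "shape_operator M (section_at \<Sigma> t) (section_normal t) x u = r *\<^sub>R q (A (u, 0))"
    if u: "u \<in> T0" for u
  proof -
    have uT: "(u, 0) \<in> T" using u unfolding T T0 by simp
    have \<Gamma>: "christoffel M (chart_at M x) (cmap M (chart_at M x) x) u (section_normal t x)
        = r *\<^sub>R christoffel M (chart_at M x) (cmap M (chart_at M x) x) u (\<nu> p)"
      using bilinear_rmul[OF christoffel_bilinear[OF chart_at]] by (simp add: section_normal_def r_def R_def xt)
    have "shape_operator M (section_at \<Sigma> t) (section_normal t) x u
        = r *\<^sub>R fst (A (u, 0)) - m u *\<^sub>R \<nu> p"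
      using cov_deriv_eq[OF xsec _ H, of u] u unfolding T0_def shape_operator_def \<Gamma>
      by (simp add: A_eq algebra_simps)
    \<comment> \<open>\<open>a\<close> collects \<open>m u\<close> and the correction made by
      \<open>q\<close>. The left-hand side and \<open>q (A (u, 0))\<close> are both orthogonal to
      \<open>\<nu> p\<close>, whose square is \<open>R > 0\<close>, and this gives
      \<open>a = 0\<close>.\<close>
    then obtain a where a: "shape_operator M (section_at \<Sigma> t) (section_normal t) x u = r *\<^sub>R q (A (u, 0)) + a *\<^sub>R \<nu> p"
      using that[of "- m u - r * (\<theta> p * snd (A (u, 0)) / R)"]
      by (simp add: q_def algebra_simps)
    have "inner_at M x (section_normal t x) (cov_deriv M (section_at \<Sigma> t) (section_normal t) x u) = 0"
      using cov_deriv_unit_normal[OF hypersurface_section unit_normal_section xsec] u unfolding T0_def .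
    then have "inner_at M x (\<nu> p) (shape_operator M (section_at \<Sigma> t) (section_normal t) x u) = 0"
      using r(2) by (simp add: section_normal_def shape_operator_def inner_at_simps xt r_def R_def)
    moreover have "inner_at M x (\<nu> p) (q (A (u, 0))) = 0"
      using q_T0[of "A (u, 0)"] A(2) uT unfolding T0 by blast
    ultimately have "a * R = 0" unfolding a by (simp add: inner_at_simps \<nu>\<nu>)
    then show ?thesis using a R by simp
  qed
  have sub: "subspace T" "subspace T0"
    unfolding T_def T0_def
    using prod.subspace_tangent_space[OF hyp p] subspace_tangent_space[OF hypersurface_section xsec] .
  have lin: "linear (\<lambda>u::'e. (u, 0::real))" "linear q" "linear (\<lambda>w::'e \<times> real. snd w / R)"
    by (intro linearI; simp add: q_def algebra_simps add_divide_distrib)+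
  have linq: "linear (\<lambda>u. q (A (u, 0)))"
    using linear_compose[OF linear_compose[OF lin(1) A(1)] lin(2)] by (simp add: o_def)
  have imq: "(\<lambda>u. q (A (u, 0))) ` T0 \<subseteq> T0"
  proof (rule image_subsetI)
    fix u assume "u \<in> T0"
    then have "(u, 0) \<in> T" unfolding T T0 by simp
    then show "q (A (u, 0)) \<in> T0" using q_T0 A(2) by blast
  qed
  have "mean_curvature (prod_R M) \<Sigma> N p = trace_on T A"
    unfolding mean_curvature_def T_def[symmetric] by (rule trace_on_cong[OF sub(1) A(3)])
  also have "\<dots> = trace_on T0 (\<lambda>u. q (A (u, 0))) + snd (A (height_gradient p)) / R"
  proof (rule trace_on_split[OF sub(2,1) A(1,2) lin])
    show "height_gradient p \<in> T" unfolding T_def by (rule height_gradient_tangent[OF p])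
    show "(u, 0) \<in> T" if "u \<in> T0" for u using that unfolding T T0 by simp
    show "w = (q w, 0) + (snd w / R) *\<^sub>R height_gradient p" if "w \<in> T" for w
      using R by (simp add: prod_eq_iff q_def height_gradient_def R_def)
  qed (use q_T0 in auto)
  also have "mean_curvature M (section_at \<Sigma> t) (section_normal t) x = r * trace_on T0 (\<lambda>u. q (A (u, 0)))"
  proof -
    have "mean_curvature M (section_at \<Sigma> t) (section_normal t) x = trace_on T0 (\<lambda>u. r *\<^sub>R q (A (u, 0)))"
      unfolding mean_curvature_def T0_def[symmetric] by (rule trace_on_cong[OF sub(2) shape])
    then show ?thesis using trace_on_scaleR[OF sub(2) linq imq] by simp
  qed
  then have "trace_on T0 (\<lambda>u. q (A (u, 0))) = sqrt R * mean_curvature M (section_at \<Sigma> t) (section_normal t) x"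
    using r by (simp add: mult.assoc[symmetric] mult.commute)
  also have "snd (A (height_gradient p)) =
      inner_at (prod_R M) p (shape_operator (prod_R M) \<Sigma> N p (height_gradient p)) (height_gradient p)"
  proof -
    have z: "height_gradient p \<in> T" unfolding T_def by (rule height_gradient_tangent[OF p])
    then have "A (height_gradient p) \<in> tangent_space (prod_R M) \<Sigma> p" using A(2) unfolding T_def by blast
    from inner_height_gradient[OF p this] show ?thesis unfolding A(3)[OF z] by simp
  qed
  finally show ?thesis by (simp only: xt fst_conv snd_conv R_def)
qed

text \<open>On \<open>T\<Sigma>\<close> one has \<open>A\<^sub>L X = - e A X - 2 e\<^sup>3 \<langle>A X, \<nabla>\<xi>\<rangle> \<nabla>\<xi>\<close> with \<open>e = 1 / sqrt (2\<Theta>\<^sup>2 - 1)\<close>, because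
  \<open>X(\<Theta>) = - \<langle>A X, \<nabla>\<xi>\<rangle>\<close>.\<close>

lemma lorentz_mean_curvature_eq:
  assumes p: "p \<in> \<Sigma>" and D: "2 * (\<theta> p)\<^sup>2 > 1"
  defines "e \<equiv> 1 / sqrt (2 * (\<theta> p)\<^sup>2 - 1)"
  shows "lorentz_mean_curvature M \<Sigma> N p = e * mean_curvature (prod_R M) \<Sigma> N p
    + 2 * e ^ 3 * inner_at (prod_R M) p
        (shape_operator (prod_R M) \<Sigma> N p (height_gradient p)) (height_gradient p)"
proof -
  define k where "k = chart_at M (fst p)"
  define z0 where "z0 = cmap (prod_R M) k p"
  define T where "T = tangent_space (prod_R M) \<Sigma> p"
  define \<Gamma> where "\<Gamma> = christoffel (prod_R M) k z0"
  obtain F F' where F: "prod.local_extension \<Sigma> p N F F'" by (rule local_extension_prod[OF p])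
  define A where "A X = - (F' X + \<Gamma> X (N p))" for X
  have A: "linear A" "A ` T \<subseteq> T" "\<And>X. X \<in> T \<Longrightarrow> shape_operator (prod_R M) \<Sigma> N p X = A X"
    using prod.shape_operator_linear[OF hyp nrm p F] unfolding A_def T_def \<Gamma>_def z0_def k_def by simp_all
  have \<Gamma>: "\<Gamma> X Y = (christoffel M k (cmap M k (fst p)) (fst X) (fst Y), 0)" for X Y
    using christoffel_product[of "fst p" k "snd p" X Y] chart_at by (simp add: \<Gamma>_def z0_def k_def)
  obtain U where U: "open U" "z0 \<in> U"
    and ext: "\<And>q. q \<in> \<Sigma> \<Longrightarrow> q \<in> cdom (prod_R M) k \<Longrightarrow> cmap (prod_R M) k q \<in> U \<Longrightarrow>
       F (cmap (prod_R M) k q) = coords (prod_R M) k q (N q)"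
    and F': "(F has_derivative F') (at z0)"
    using F unfolding prod.local_extension_def by (auto simp: k_def z0_def)
  have Fx: "F z0 = N p"
    using prod.local_extension_at[OF F p] by (simp add: k_def z0_def)
  define \<mu> where "\<mu> r = - 1 / sqrt (2 * r\<^sup>2 - 1)" for r :: real
  have e: "e > 0" "\<mu> (\<theta> p) = - e" using D by (simp_all add: e_def \<mu>_def)
  \<comment> \<open>Expresses everything by the cube of \<open>e\<close>, the power produced by
    differentiating \<mu>.\<close>
  have e3: "e = e ^ 3 * (2 * (\<theta> p)\<^sup>2 - 1)"
    using D by (simp add: e_def power3_eq_cube field_simps)
  \<comment> \<open>The derivative of \<open>- (2 * r\<^sup>2 - 1) powr (-1/2)\<close> is
    \<open>2 * r * (2 * r\<^sup>2 - 1) powr (-3/2)\<close>.\<close>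
  have "(\<mu> has_real_derivative (2 * \<theta> p * e ^ 3)) (at (\<theta> p))"
    unfolding \<mu>_def e_def using D
    by (auto intro!: derivative_eq_intros simp: power3_eq_cube field_simps)
  then have "(\<mu> has_derivative (\<lambda>s. (2 * \<theta> p * e ^ 3) * s)) (at (snd (F z0)))"
    by (simp add: Fx has_field_derivative_def)
  from has_derivative_compose[OF has_derivative_snd[OF F'] this]
  have \<mu>': "((\<lambda>y. \<mu> (snd (F y))) has_derivative (\<lambda>X. (2 * \<theta> p * e ^ 3) * snd (F' X))) (at z0)" .
  have "((\<lambda>y. F y - (2 * snd (F y)) *\<^sub>R vertical) has_derivative
      (\<lambda>X. F' X - (2 * snd (F' X)) *\<^sub>R vertical)) (at z0)"
    by (intro has_derivative_diff F' has_derivative_scaleR_left has_derivative_mult_right has_derivative_snd)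
  from has_derivative_scaleR[OF \<mu>' this]
  have L': "((\<lambda>y. \<mu> (snd (F y)) *\<^sub>R (F y - (2 * snd (F y)) *\<^sub>R vertical)) has_derivative
      (\<lambda>X. (- e) *\<^sub>R (F' X - (2 * snd (F' X)) *\<^sub>R vertical)
         + (2 * \<theta> p * e ^ 3 * snd (F' X)) *\<^sub>R (N p - (2 * \<theta> p) *\<^sub>R vertical))) (at z0)"
    by (simp only: Fx e)
  have "\<mu> (snd (F (cmap (prod_R M) k q))) *\<^sub>R
        (F (cmap (prod_R M) k q) - (2 * snd (F (cmap (prod_R M) k q))) *\<^sub>R vertical)
      = coords (prod_R M) k q (lorentz_normal M N q)"
    if "q \<in> \<Sigma> \<inter> cdom (prod_R M) k" "cmap (prod_R M) k q \<in> U" for q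
  proof -
    have q: "fst q \<in> cdom M k" using that by auto
    then have "F (cmap (prod_R M) k q) = (coords M k (fst q) (\<nu> q), \<theta> q)"
      using ext[of q] that coords_product[of q k 1] by simp
    then show ?thesis
      using coords_product[OF q, of 1] linear_scale[OF coords_linear[OF q]] linear_neg[OF coords_linear[OF q]]
      by (simp add: lorentz_normal_def vertical_def \<mu>_def prod_eq_iff)
  qed
  then have ext_L: "prod.local_extension \<Sigma> p (lorentz_normal M N)
      (\<lambda>y. \<mu> (snd (F y)) *\<^sub>R (F y - (2 * snd (F y)) *\<^sub>R vertical))
      (\<lambda>X. (- e) *\<^sub>R (F' X - (2 * snd (F' X)) *\<^sub>R vertical)
         + (2 * \<theta> p * e ^ 3 * snd (F' X)) *\<^sub>R (N p - (2 * \<theta> p) *\<^sub>R vertical))"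
    unfolding prod.local_extension_def product_with_line_simps(4) k_def[symmetric] z0_def[symmetric]
    using U L' by blast
  \<comment> \<open>The vertical field is parallel, so only the \<open>N\<close> part of the
    Lorentzian normal contributes.\<close>
  have \<Gamma>_L: "\<Gamma> X (lorentz_normal M N p) = (- e) *\<^sub>R \<Gamma> X (N p)" for X
    using bilinear_rmul[OF christoffel_bilinear[of "fst p" k]]
      bilinear_rneg[OF christoffel_bilinear[of "fst p" k]] chart_at e(2)
    by (simp add: \<Gamma> lorentz_normal_def vertical_def \<mu>_def k_def)
  \<comment> \<open>Christoffel vectors of the product are horizontal, so the derivative of the
    angle along \<open>X\<close> is minus the vertical component of \<open>A X\<close>.\<close>
  have sA: "snd (F' X) = - snd (A X)" for X by (simp add: A_def \<Gamma>)
  have shape: "lorentz_shape_operator M \<Sigma> N p X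
      = (- e) *\<^sub>R A X + (- 2 * e ^ 3 * snd (A X)) *\<^sub>R height_gradient p" if X: "X \<in> T" for X
  proof -
    define s where "s = snd (F' X)"
    have "lorentz_shape_operator M \<Sigma> N p X = - ((- e) *\<^sub>R (F' X - (2 * s) *\<^sub>R vertical)
         + (2 * \<theta> p * e ^ 3 * s) *\<^sub>R (N p - (2 * \<theta> p) *\<^sub>R vertical) + (- e) *\<^sub>R \<Gamma> X (N p))"
      using prod.cov_deriv_eq[OF p _ ext_L, of X] X \<Gamma>_L[of X]
      unfolding lorentz_shape_operator_def T_def s_def \<Gamma>_def z0_def k_def by simp
    also have "\<dots> = (- e) *\<^sub>R A X + (2 * e ^ 3 * s) *\<^sub>R height_gradient p"
    proof (rule prod_eqI)
      show "fst (- ((- e) *\<^sub>R (F' X - (2 * s) *\<^sub>R vertical)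
         + (2 * \<theta> p * e ^ 3 * s) *\<^sub>R (N p - (2 * \<theta> p) *\<^sub>R vertical) + (- e) *\<^sub>R \<Gamma> X (N p)))
        = fst ((- e) *\<^sub>R A X + (2 * e ^ 3 * s) *\<^sub>R height_gradient p)"
        by (simp add: A_def vertical_def height_gradient_def algebra_simps)
      have "- (- e * (s - 2 * s) + (2 * \<theta> p * e ^ 3 * s) * (\<theta> p - 2 * \<theta> p))
          = - e * - s + (2 * e ^ 3 * s) * (1 - (\<theta> p)\<^sup>2)"
        using e3 by algebra
      then show "snd (- ((- e) *\<^sub>R (F' X - (2 * s) *\<^sub>R vertical)
         + (2 * \<theta> p * e ^ 3 * s) *\<^sub>R (N p - (2 * \<theta> p) *\<^sub>R vertical) + (- e) *\<^sub>R \<Gamma> X (N p)))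
        = snd ((- e) *\<^sub>R A X + (2 * e ^ 3 * s) *\<^sub>R height_gradient p)"
        using sA[of X] by (simp add: \<Gamma> vertical_def height_gradient_def s_def)
    qed
    finally show ?thesis by (simp add: s_def sA)
  qed
  have sub: "subspace T" unfolding T_def by (rule prod.subspace_tangent_space[OF hyp p])
  have z: "height_gradient p \<in> T" unfolding T_def by (rule height_gradient_tangent[OF p])
  have "linear (\<lambda>X. - 2 * e ^ 3 * snd (A X))"
    using A(1) by (intro linearI) (simp_all add: linear_add linear_scale algebra_simps)
  from trace_on_rank_one_update[OF sub A(1,2) this z, of "- e"]
  have "lorentz_mean_curvature M \<Sigma> N p = e * trace_on T A + 2 * e ^ 3 * snd (A (height_gradient p))"
    unfolding lorentz_mean_curvature_def T_def[symmetric]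
    using trace_on_cong[OF sub shape] by simp
  moreover have "mean_curvature (prod_R M) \<Sigma> N p = trace_on T A"
    unfolding mean_curvature_def T_def[symmetric] by (rule trace_on_cong[OF sub A(3)])
  moreover have "inner_at (prod_R M) p (A (height_gradient p)) (height_gradient p) = snd (A (height_gradient p))"
    using inner_height_gradient[OF p, of "A (height_gradient p)"] A(2) z unfolding T_def by blast
  ultimately show ?thesis using A(3)[OF z] by simp
qed

section \<open>From the curvature identities to the equivalences\<close>

text \<open>The height gradient alone detects this: its Lorentzian square is
  \<open>(1 - \<Theta>\<^sup>2) * (2 * \<Theta>\<^sup>2 - 1)\<close>, and the first factor is
  positive.\<close>

lemma spacelike_angle:
  assumes "spacelike M \<Sigma>" and p: "p \<in> \<Sigma>"
  shows "2 * (\<theta> p)\<^sup>2 > 1"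
proof -
  have R: "1 - (\<theta> p)\<^sup>2 > 0" using angle_less_1[OF p] by simp
  have "height_gradient p \<noteq> 0" using R by (auto simp: height_gradient_def prod_eq_iff)
  then have "0 < inner_at (prod_L M) p (height_gradient p) (height_gradient p)"
    using assms height_gradient_tangent[OF p] unfolding spacelike_def by blast
  also have "\<dots> = (1 - (\<theta> p)\<^sup>2) * (2 * (\<theta> p)\<^sup>2 - 1)"
    by (simp add: height_gradient_def inner_at_simps inner_horizontal[OF p] power2_eq_square algebra_simps)
  finally show ?thesis using R by (simp add: zero_less_mult_iff)
qed

lemma minimal_sections_iff:
  "minimal_sections M \<Sigma> \<longleftrightarrow>
    (\<forall>p\<in>\<Sigma>. mean_curvature M (section_at \<Sigma> (snd p)) (section_normal (snd p)) (fst p) = 0)"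
  using minimal_hypersurface_iff[OF hypersurface_section unit_normal_section] transversal
  by (auto simp: minimal_sections_def mem_section_at Ball_def)

lemma helicoid_equivalences:
  assumes "\<not> angle M N constant_on \<Sigma>"
  shows "vertical_helicoid M \<Sigma> N \<longleftrightarrow> minimal_hypersurface (prod_R M) \<Sigma> \<and> minimal_sections M \<Sigma>"
    and "spacelike M \<Sigma> \<Longrightarrow>
      minimal_hypersurface (prod_R M) \<Sigma> \<and> minimal_sections M \<Sigma> \<longleftrightarrow> zero_mean_isocurved M \<Sigma> N"
proof -
  let ?H = "mean_curvature (prod_R M) \<Sigma> N"
  let ?K = "\<lambda>p. mean_curvature M (section_at \<Sigma> (snd p)) (section_normal (snd p)) (fst p)"
  let ?Q = "\<lambda>p. inner_at (prod_R M) p (shape_operator (prod_R M) \<Sigma> N p (height_gradient p)) (height_gradient p)"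
  have eq: "?H p = sqrt (1 - (\<theta> p)\<^sup>2) * ?K p + ?Q p / (1 - (\<theta> p)\<^sup>2)" "1 - (\<theta> p)\<^sup>2 > 0" if "p \<in> \<Sigma>" for p
    using mean_curvature_section[OF that] angle_less_1[OF that] by simp_all
  have hel: "vertical_helicoid M \<Sigma> N \<longleftrightarrow> (\<forall>p\<in>\<Sigma>. ?K p = 0 \<and> ?Q p = 0)"
    unfolding vertical_helicoid_def minimal_sections_iff
    using hyp nrm no_horizontal assms gradient_on_height by (auto simp del: inner_at_product_with_line)
  have min: "minimal_hypersurface (prod_R M) \<Sigma> \<and> minimal_sections M \<Sigma> \<longleftrightarrow> (\<forall>p\<in>\<Sigma>. ?H p = 0 \<and> ?K p = 0)"
    unfolding minimal_sections_iff prod.minimal_hypersurface_iff[OF hyp nrm] by blast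
  \<comment> \<open>Both coefficients in \<open>eq\<close> are positive, so the vanishing of any two
    of \<open>?H\<close>, \<open>?K\<close> and \<open>?Q\<close> forces that of the third.\<close>
  have HK: "?H p = 0 \<and> ?K p = 0 \<longleftrightarrow> ?K p = 0 \<and> ?Q p = 0" "?H p = 0 \<and> ?K p = 0 \<longleftrightarrow> ?H p = 0 \<and> ?Q p = 0"
    if "p \<in> \<Sigma>" for p
    using eq[OF that] by (auto simp del: inner_at_product_with_line)
  show "vertical_helicoid M \<Sigma> N \<longleftrightarrow> minimal_hypersurface (prod_R M) \<Sigma> \<and> minimal_sections M \<Sigma>"
    unfolding hel min using HK(1) by blast
  assume sp: "spacelike M \<Sigma>"
  \<comment> \<open>In the formula for the Lorentzian mean curvature the coefficient of
    \<open>?Q\<close> is positive; once \<open>?H\<close> vanishes, the other two vanish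
    together.\<close>
  have HL: "?H p = 0 \<and> lorentz_mean_curvature M \<Sigma> N p = 0 \<longleftrightarrow> ?H p = 0 \<and> ?Q p = 0" if "p \<in> \<Sigma>" for p
    using lorentz_mean_curvature_eq[OF that spacelike_angle[OF sp that]] spacelike_angle[OF sp that]
    by (auto simp del: inner_at_product_with_line)
  show "minimal_hypersurface (prod_R M) \<Sigma> \<and> minimal_sections M \<Sigma> \<longleftrightarrow> zero_mean_isocurved M \<Sigma> N"
    unfolding min zero_mean_isocurved_def using hyp nrm sp HL HK(2) by blast
qed

end

theorem theorem1:
  fixes M :: "('i, 'm::{t2_space,second_countable_topology}, 'e::euclidean_space) manifold_data"
    and \<Sigma> :: "('m \<times> real) set"
    and N :: "'m \<times> real \<Rightarrow> 'e \<times> real"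
  assumes "riemannian_manifold M"
    and "DIM('e) \<ge> 2"
    and "hypersurface (prod_R M) \<Sigma>"
    and "unit_normal (prod_R M) \<Sigma> N"
    and "\<forall>p\<in>\<Sigma>. \<not> horizontal_point M \<Sigma> p"
    and "\<not> angle M N constant_on \<Sigma>"
  shows "(vertical_helicoid M \<Sigma> N \<longleftrightarrow>
            minimal_hypersurface (prod_R M) \<Sigma> \<and> minimal_sections M \<Sigma>) \<and>
         (spacelike M \<Sigma> \<longrightarrow>
            (vertical_helicoid M \<Sigma> N \<longleftrightarrow> zero_mean_isocurved M \<Sigma> N) \<and>
            (minimal_hypersurface (prod_R M) \<Sigma> \<and> minimal_sections M \<Sigma> \<longleftrightarrow>
               zero_mean_isocurved M \<Sigma> N))"
proof -
  interpret no_horizontal_points M \<Sigma> N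
    using assms(1,3,4,5) by unfold_locales auto
  show ?thesis using helicoid_equivalences[OF assms(6)] by blast
qed

end
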